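(* Let $\mathbb{Z}^d$ have a non-singular and ergodic action on a standard probability space $(X,\mu)$, let $\rho$ be a rectangular metric on $\mathbb{Z}^d$, and let $B_n=\{u\in\mathbb{Z}^d:\rho(u,0)\le n\}$. Then for every $\phi\in L^1(X,\mu)$, as $n\to\infty$, $$\frac{\sum_{u\in B_n}\hat{u}\phi}{\sum_{u\in B_n}\hat{u}1}\to\int\phi\,d\mu\qquad\mu\text{-almost everywhere}.$$
   Context: The action is non-singular if $\mu\circ u\sim\mu$ for each $u\in\mathbb{Z}^d$; then $\omega_u=\frac{d\mu\circ u}{d\mu}$ and $\hat{u}\phi(x)=\phi(ux)\,\omega_u(x)$, so $\hat u1=\omega_u$. Rectangular metric: a metric on $\mathbb{Z}^d$ of the form $\rho(u,v)=\max_{1\le i\le d}F_i(|u_i-v_i|)$, where each $F_i:[0,\infty)\to[0,\infty)$ satisfies $F_i(0)=0$, is subadditive and strictly increasing, and has an inverse $f_i:[0,\infty)\to[0,\infty)$ (i.e. $F_i$ is a bijection of $[0,\infty)$). Then $B_n=\prod_{i=1}^d[-\lfloor f_i(n)\rfloor,\lfloor f_i(n)\rfloor]$ (a product of sets of integers). *)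

theory Defs
  imports "HOL-Probability.Probability"
begin

definition standard_borel :: "'x measure \<Rightarrow> bool" where
  "standard_borel M \<longleftrightarrow>
     (\<exists>S. completely_metrizable_space S \<and> second_countable S \<and> topspace S = space M \<and>
          sets M = sigma_sets (space M) {U. openin S U})"

definition standard_probability_space :: "'x measure \<Rightarrow> bool" where
  "standard_probability_space M \<longleftrightarrow> standard_borel M \<and> prob_space M"

definition measurable_action :: "'x measure \<Rightarrow> ('g::group_add \<Rightarrow> 'x \<Rightarrow> 'x) \<Rightarrow> bool" where
  "measurable_action M T \<longleftrightarrow>
     (\<forall>u. T u \<in> measurable M M) \<and>
     (\<forall>x\<in>space M. T 0 x = x) \<and>
     (\<forall>u v. \<forall>x\<in>space M. T (u + v) x = T u (T v x))"

text \<open>The measure \<open>\<mu> \<circ> u\<close>, that is, \<open>A \<mapsto> \<mu> (u A)\<close>. Since \<open>u A\<close> is the preimage of \<open>A\<close> under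
  \<open>- u\<close>, it is the push-forward of \<open>\<mu>\<close> along \<open>- u\<close>; see \<open>emeasure_comp_measure\<close> below.\<close>

definition comp_measure :: "'x measure \<Rightarrow> ('g::group_add \<Rightarrow> 'x \<Rightarrow> 'x) \<Rightarrow> 'g \<Rightarrow> 'x measure" where
  "comp_measure M T u = distr M M (T (- u))"

lemma emeasure_comp_measure:
  assumes T: "measurable_action M T" and A: "A \<in> sets M"
  shows "emeasure (comp_measure M T u) A = emeasure M (T u ` A)"
proof -
  have AX: "A \<subseteq> space M" using A by (rule sets.sets_into_space)
  have meas: "T v \<in> measurable M M" for v
    using T by (simp add: measurable_action_def)
  have inv: "T (- u) (T u x) = x" "T u (T (- u) x) = x" if "x \<in> space M" for x
    using T that unfolding measurable_action_def
    by (metis left_minus, metis right_minus)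
  have "T (- u) -` A \<inter> space M = T u ` A"
  proof (intro subset_antisym subsetI)
    fix x assume "x \<in> T (- u) -` A \<inter> space M"
    then have "T (- u) x \<in> A" "T u (T (- u) x) = x" using inv by auto
    then show "x \<in> T u ` A" by force
  next
    fix x assume "x \<in> T u ` A"
    then obtain y where y: "y \<in> A" "x = T u y" by auto
    then show "x \<in> T (- u) -` A \<inter> space M"
      using AX inv(1)[of y] measurable_space[OF meas, of y u] by auto
  qed
  then show ?thesis
    unfolding comp_measure_def using emeasure_distr[OF meas A] by simp
qed

definition nonsingular_action :: "'x measure \<Rightarrow> ('g::group_add \<Rightarrow> 'x \<Rightarrow> 'x) \<Rightarrow> bool" where
  "nonsingular_action M T \<longleftrightarrow>
     measurable_action M T \<and>
     (\<forall>u. absolutely_continuous M (comp_measure M T u) \<and>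
          absolutely_continuous (comp_measure M T u) M)"

definition ergodic_action :: "'x measure \<Rightarrow> ('g::group_add \<Rightarrow> 'x \<Rightarrow> 'x) \<Rightarrow> bool" where
  "ergodic_action M T \<longleftrightarrow>
     measurable_action M T \<and>
     (\<forall>A\<in>sets M. (\<forall>u. T u -` A \<inter> space M = A) \<longrightarrow>
        emeasure M A = 0 \<or> emeasure M (space M - A) = 0)"

definition omega :: "'x measure \<Rightarrow> ('g::group_add \<Rightarrow> 'x \<Rightarrow> 'x) \<Rightarrow> 'g \<Rightarrow> 'x \<Rightarrow> real" where
  "omega M T u x = enn2real (RN_deriv M (comp_measure M T u) x)"

definition hat_op ::
    "'x measure \<Rightarrow> ('g::group_add \<Rightarrow> 'x \<Rightarrow> 'x) \<Rightarrow> 'g \<Rightarrow> ('x \<Rightarrow> real) \<Rightarrow> 'x \<Rightarrow> real" where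
  "hat_op M T u \<phi> x = \<phi> (T u x) * omega M T u x"

definition rectangular_gauge :: "(real \<Rightarrow> real) \<Rightarrow> bool" where
  "rectangular_gauge F \<longleftrightarrow>
     F 0 = 0 \<and>
     (\<forall>s\<ge>0. \<forall>t\<ge>0. F (s + t) \<le> F s + F t) \<and>
     strict_mono_on {0..} F \<and>
     bij_betw F {0..} {0..}"

definition rectangular_metric :: "(int ^ 'd \<Rightarrow> int ^ 'd \<Rightarrow> real) \<Rightarrow> bool" where
  "rectangular_metric \<rho> \<longleftrightarrow>
     Metric_space UNIV \<rho> \<and>
     (\<exists>F :: 'd \<Rightarrow> real \<Rightarrow> real. (\<forall>i. rectangular_gauge (F i)) \<and>
        (\<forall>u v. \<rho> u v = (MAX i. F i \<bar>of_int (u $ i) - of_int (v $ i)\<bar>)))"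

definition metric_box :: "(int ^ 'd \<Rightarrow> int ^ 'd \<Rightarrow> real) \<Rightarrow> nat \<Rightarrow> (int ^ 'd) set" where
  "metric_box \<rho> n = {u. \<rho> u 0 \<le> real n}"

lemma metric_box_eq:
  fixes F :: "'d::finite \<Rightarrow> real \<Rightarrow> real"
  assumes F: "\<And>i. rectangular_gauge (F i)"
    and rho: "\<And>u v. \<rho> u v = (MAX i. F i \<bar>of_int (u $ i) - of_int (v $ i)\<bar>)"
  shows "metric_box \<rho> n = {u. \<forall>i. \<bar>u $ i\<bar> \<le> \<lfloor>the_inv_into {0..} (F i) (real n)\<rfloor>}"
proof -
  have le_iff: "F i \<bar>of_int k\<bar> \<le> real n \<longleftrightarrow> \<bar>k\<bar> \<le> \<lfloor>the_inv_into {0..} (F i) (real n)\<rfloor>"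
    for i and k :: int
  proof -
    let ?f = "the_inv_into {0..} (F i) (real n)"
    have bij: "bij_betw (F i) {0..} {0..}" and mono: "strict_mono_on {0..} (F i)"
      using F[of i] by (simp_all add: rectangular_gauge_def)
    have f: "F i ?f = real n" "?f \<ge> 0"
      using bij f_the_inv_into_f_bij_betw[OF bij, of "real n"]
        bij_betwE[OF bij_betw_the_inv_into[OF bij]] by auto
    have "F i \<bar>of_int k\<bar> \<le> F i ?f \<longleftrightarrow> \<bar>of_int k\<bar> \<le> ?f"
      using strict_mono_on_less_eq[OF mono] f(2) by simp
    also have "\<dots> \<longleftrightarrow> \<bar>k\<bar> \<le> \<lfloor>?f\<rfloor>" by (simp add: le_floor_iff)
    finally show ?thesis using f(1) by simp
  qed
  show ?thesis by (simp add: metric_box_def rho le_iff)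
qed

lemma finite_metric_box:
  fixes \<rho> :: "int ^ 'd \<Rightarrow> int ^ 'd \<Rightarrow> real"
  assumes "rectangular_metric \<rho>"
  shows "finite (metric_box \<rho> n)"
proof -
  obtain F :: "'d \<Rightarrow> real \<Rightarrow> real" where F: "\<And>i. rectangular_gauge (F i)"
    "\<And>u v. \<rho> u v = (MAX i. F i \<bar>of_int (u $ i) - of_int (v $ i)\<bar>)"
    using assms unfolding rectangular_metric_def by blast
  define b where "b i = \<lfloor>the_inv_into {0..} (F i) (real n)\<rfloor>" for i
  have "metric_box \<rho> n \<subseteq> vec_lambda ` (Pi\<^sub>E UNIV (\<lambda>i. {- b i..b i}))"
  proof
    fix u assume "u \<in> metric_box \<rho> n"
    then have "\<forall>i. \<bar>u $ i\<bar> \<le> b i"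
      unfolding metric_box_eq[of F, OF F] b_def by simp
    then have "vec_nth u \<in> Pi\<^sub>E UNIV (\<lambda>i. {- b i..b i})" by (auto simp: abs_le_iff minus_le_iff)
    then show "u \<in> vec_lambda ` (Pi\<^sub>E UNIV (\<lambda>i. {- b i..b i}))"
      by (intro image_eqI[of _ _ "vec_nth u"]) auto
  qed
  then show ?thesis by (rule finite_subset) (intro finite_imageI finite_PiE; simp)
qed

end

theory Submission
  imports Defs
begin

text \<open>
  Write \<open>m(v) = \<omega>\<^sub>v(x)\<close> for the mass that a point \<open>x\<close> induces on the group. Boxes of a nested family, centred at
  the points of a finite set, satisfy a Besicovitch covering property with multiplicity \<open>2\<^sup>d\<close>; by transference this
  gives a weak type maximal inequality for the ratios, so the set of functions for which the theorem
  holds is closed in \<open>L\<^sup>1\<close>. By an \<open>L\<^sup>2\<close> projection and ergodicity, constants and bounded coboundaries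
  \<open>hat u \<psi> - \<psi>\<close> span a dense subspace, and for a coboundary the theorem says that the boundary of
  a box carries a negligible part of its mass.

  Suppose that, on a set of positive measure, a face of the box carries a fraction \<open>\<epsilon>\<close> of its mass at infinitely
  many scales. Proceed from large to small scales and cover the bad points by boxes with heavy faces.
  Near a given point the faces used so far lie in boundedly many hyperplanes, since a box
  that meets a smaller box contains one of its corners. With sufficiently many scales to choose from, the new faces
  can avoid all of these hyperplanes. This produces arbitrarily many disjoint sets, each with a fixed fraction of the mass,
  which is absurd.
\<close>

section \<open>Boxes in the integer lattice\<close>

text \<open>For a measure-preserving action the faces of large boxes are negligible by counting
  points. Here the weights \<open>\<omega> v x\<close> may concentrate on a face, and the sides may
  grow at unrelated rates with no doubling bound on the mass, so no single scale gives a
  contradiction. The faces at different levels have to be compared, and disjointness is what makes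
  them comparable: one covering of the bad points yields faces of total mass at least
  \<open>\<epsilon> / 2 ^ CARD('d)\<close> times the bad mass, and these contributions add up over
  the levels. The order of the levels matters because only a box at least as large as the current
  one is sure to contain one of its corners. With \<open>2 ^ CARD('d)\<close> corners and covering
  multiplicity \<open>2 ^ CARD('d)\<close>, each earlier level leaves at most
  \<open>4 ^ CARD('d)\<close> hyperplanes to avoid. A further obstacle is that points are bad at
  unrelated scales, while levels must be ordered uniformly along an orbit. Hence windows of scales
  are fixed in advance, in each of which all but a small part of the bad set has a bad
  scale.\<close>

definition int_box :: "('d \<Rightarrow> int) \<Rightarrow> int ^ 'd \<Rightarrow> (int ^ 'd) set" where
  "int_box r u = {v. \<forall>i. \<bar>v $ i - u $ i\<bar> \<le> r i}"

lemma mem_int_box: "v \<in> int_box r u \<longleftrightarrow> (\<forall>i. \<bar>v $ i - u $ i\<bar> \<le> r i)"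
  by (simp add: int_box_def)

lemma int_box_mono:
  assumes "r \<le> r'"
  shows "int_box r u \<subseteq> int_box r' u"
proof
  fix v assume "v \<in> int_box r u"
  then have "\<bar>v $ i - u $ i\<bar> \<le> r' i" for i
    using le_funD[OF assms, of i] by (auto simp: mem_int_box intro: order_trans)
  then show "v \<in> int_box r' u" by (simp add: mem_int_box)
qed

lemma int_box_0_eq:
  "int_box r 0 = vec_lambda ` (Pi\<^sub>E UNIV (\<lambda>i. {- r i..r i}))" (is "?L = ?R")
proof (intro subset_antisym subsetI)
  fix v assume "v \<in> ?L"
  then have "vec_nth v \<in> Pi\<^sub>E UNIV (\<lambda>i. {- r i..r i})"
    by (auto simp: mem_int_box abs_le_iff minus_le_iff)
  then show "v \<in> ?R" by (intro image_eqI[of _ _ "vec_nth v"]) auto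
next
  fix v assume "v \<in> ?R"
  then obtain f where f: "v = vec_lambda f" "f \<in> Pi\<^sub>E UNIV (\<lambda>i. {- r i..r i})" by auto
  have "- r i \<le> f i \<and> f i \<le> r i" for i using f(2) by (auto simp: PiE_iff)
  then show "v \<in> ?L" by (simp add: f(1) mem_int_box abs_le_iff minus_le_iff)
qed

lemma int_box_translate: "int_box r u = (\<lambda>v. v + u) ` int_box r 0"
proof (intro subset_antisym subsetI)
  fix v assume "v \<in> int_box r u"
  then show "v \<in> (\<lambda>v. v + u) ` int_box r 0"
    by (intro image_eqI[of _ _ "v - u"]) (auto simp: mem_int_box)
qed (auto simp: mem_int_box)

lemma finite_int_box: "finite (int_box r u)"
  unfolding int_box_translate[of r u] int_box_0_eq by (intro finite_imageI finite_PiE) auto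

lemma card_cube: "card (int_box (\<lambda>_. int N) (0 :: int ^ 'd)) = (2 * N + 1) ^ CARD('d)"
proof -
  have "inj_on vec_lambda (Pi\<^sub>E UNIV (\<lambda>i :: 'd. {- int N..int N}))"
    by (auto intro!: inj_onI simp: vec_lambda_inject)
  then have "card (int_box (\<lambda>_. int N) (0 :: int ^ 'd)) = card (Pi\<^sub>E UNIV (\<lambda>i :: 'd. {- int N..int N}))"
    unfolding int_box_0_eq by (rule card_image)
  also have "\<dots> = (2 * N + 1) ^ CARD('d)"
    by (simp add: card_PiE nat_add_distrib nat_mult_distrib algebra_simps)
  finally show ?thesis .
qed

section \<open>Besicovitch covering by nested boxes\<close>

text \<open>Greedy choice, largest scale first: each chosen box removes all remaining centres that
  it contains. Later centres lie outside it and, by symmetry of boxes, its centre lies outside the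
  box with the same radii around any later centre; hence the \<open>max\<close>.\<close>

lemma box_separated_subfamily:
  fixes n :: "int ^ 'd \<Rightarrow> nat" and b :: "nat \<Rightarrow> 'd \<Rightarrow> int"
  assumes mono: "mono b"
    and "finite A" and nonneg: "\<And>n j. 0 \<le> b n j"
  shows "\<exists>U\<subseteq>A. A \<subseteq> (\<Union>u\<in>U. int_box (b (n u)) u) \<and>
    (\<forall>u\<in>U. \<forall>u'\<in>U. u \<noteq> u' \<longrightarrow> u \<notin> int_box (b (max (n u) (n u'))) u')"
  using \<open>finite A\<close>
proof (induction A rule: finite_psubset_induct)
  case (psubset A)
  show ?case
  proof (cases "A = {}")
    case False
    define N where "N = Max (n ` A)"
    have "N \<in> n ` A" unfolding N_def using False psubset(1) by (intro Max_in) auto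
    then obtain w where w: "w \<in> A" "n w = N" by auto
    have le: "n u \<le> n w" if "u \<in> A" for u
      using that psubset(1) by (simp add: w(2) N_def)
    have ww: "w \<in> int_box (b (n w)) w" using nonneg by (simp add: mem_int_box)
    let ?A = "A - int_box (b (n w)) w"
    have "?A \<subset> A" using w ww by auto
    from psubset.IH[OF this] obtain U where U: "U \<subseteq> ?A" "?A \<subseteq> (\<Union>u\<in>U. int_box (b (n u)) u)"
      "\<forall>u\<in>U. \<forall>u'\<in>U. u \<noteq> u' \<longrightarrow> u \<notin> int_box (b (max (n u) (n u'))) u'"
      by (elim exE conjE) (rule that)
    have "u \<notin> int_box (b (max (n u) (n w))) w" "w \<notin> int_box (b (max (n w) (n u))) u" if "u \<in> U" for u
    proof -
      have "u \<in> A" "u \<notin> int_box (b (n w)) w" using that U(1) by auto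
      then show "u \<notin> int_box (b (max (n u) (n w))) w" "w \<notin> int_box (b (max (n w) (n u))) u"
        using le[of u] by (auto simp: max_absorb1 max_absorb2 mem_int_box abs_minus_commute)
    qed
    then show ?thesis
      using U w(1) by (intro exI[of _ "insert w U"]) auto
  qed auto
qed

lemma box_multiplicity:
  fixes n :: "int ^ 'd \<Rightarrow> nat" and b :: "nat \<Rightarrow> 'd \<Rightarrow> int"
  assumes mono: "mono b"
    and sep: "\<forall>u\<in>U. \<forall>u'\<in>U. u \<noteq> u' \<longrightarrow> u \<notin> int_box (b (max (n u) (n u'))) u'"
  shows "card {u \<in> U. v \<in> int_box (b (n u)) u} \<le> 2 ^ CARD('d)"
proof -
  let ?V = "{u \<in> U. v \<in> int_box (b (n u)) u}"
  \<comment> \<open>The larger of two boxes with centres in the same orthant at \<open>v\<close> would contain both centres.\<close>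
  have "inj_on (\<lambda>u. {i. v $ i \<le> u $ i}) ?V"
  proof (rule inj_onI, rule ccontr)
    fix u u' assume u: "u \<in> ?V" "u' \<in> ?V" and eq: "{i. v $ i \<le> u $ i} = {i. v $ i \<le> u' $ i}"
      and ne: "u \<noteq> u'"
    have "\<bar>u $ i - u' $ i\<bar> \<le> b (max (n u) (n u')) i" for i
    proof -
      have "\<bar>v $ i - u $ i\<bar> \<le> b (max (n u) (n u')) i" "\<bar>v $ i - u' $ i\<bar> \<le> b (max (n u) (n u')) i"
        using u le_funD[OF monoD[OF mono, of "n u" "max (n u) (n u')"], of i]
          le_funD[OF monoD[OF mono, of "n u'" "max (n u) (n u')"], of i]
        by (fastforce simp: mem_int_box intro: order_trans)+
      moreover have "v $ i \<le> u $ i \<longleftrightarrow> v $ i \<le> u' $ i" using eq by auto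
      ultimately show ?thesis by linarith
    qed
    then show False using sep u ne unfolding mem_int_box by blast
  qed
  then have "card ?V \<le> card (UNIV :: 'd set set)"
    by (rule card_inj_on_le) auto
  also have "\<dots> = 2 ^ CARD('d)" by (simp flip: Pow_UNIV add: card_Pow)
  finally show ?thesis .
qed

lemma box_covering:
  fixes n :: "int ^ 'd \<Rightarrow> nat" and b :: "nat \<Rightarrow> 'd \<Rightarrow> int"
  assumes mono: "mono b"
    and fin: "finite A" and nonneg: "\<And>n j. 0 \<le> b n j"
  obtains U where "U \<subseteq> A" "A \<subseteq> (\<Union>u\<in>U. int_box (b (n u)) u)"
    "\<And>v. card {u \<in> U. v \<in> int_box (b (n u)) u} \<le> 2 ^ CARD('d)"
proof -
  from box_separated_subfamily[where b = b and n = n, OF mono fin nonneg]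
  obtain U where U: "U \<subseteq> A" "A \<subseteq> (\<Union>u\<in>U. int_box (b (n u)) u)"
    "\<forall>u\<in>U. \<forall>u'\<in>U. u \<noteq> u' \<longrightarrow> u \<notin> int_box (b (max (n u) (n u'))) u'"
    by (elim exE conjE) (rule that)
  show thesis using U(1,2) box_multiplicity[where b = b and n = n, OF mono U(3)] by (rule that)
qed

lemma sum_UNION_le:
  fixes m :: "'a \<Rightarrow> real"
  assumes "finite U" "\<And>u. u \<in> U \<Longrightarrow> finite (F u)" "\<And>v. 0 \<le> m v" "A \<subseteq> (\<Union>u\<in>U. F u)"
  shows "sum m A \<le> (\<Sum>u\<in>U. sum m (F u))"
proof -
  have "sum m A \<le> sum m (\<Union>u\<in>U. F u)" using assms by (intro sum_mono2) auto
  also have "\<dots> \<le> (\<Sum>u\<in>U. sum m (F u))"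
    using \<open>finite U\<close> assms(2)
  proof (induction U rule: finite_induct)
    case (insert x U)
    have "sum m (F x \<union> (\<Union>u\<in>U. F u)) \<le> sum m (F x) + sum m (\<Union>u\<in>U. F u)"
      using insert by (subst sum_Un) (auto intro!: sum_nonneg assms)
    then show ?case using insert by (auto intro: order_trans)
  qed auto
  finally show ?thesis .
qed

lemma sum_multiplicity_le:
  fixes m :: "'a \<Rightarrow> real"
  assumes "finite U" "finite W" "\<And>u. u \<in> U \<Longrightarrow> F u \<subseteq> W" "\<And>v. 0 \<le> m v"
    and mult: "\<And>v. v \<in> W \<Longrightarrow> card {u \<in> U. v \<in> F u} \<le> C"
  shows "(\<Sum>u\<in>U. sum m (F u)) \<le> C * sum m W"
proof -
  have "(\<Sum>u\<in>U. sum m (F u)) = (\<Sum>u\<in>U. \<Sum>v\<in>W. if v \<in> F u then m v else 0)"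
  proof (rule sum.cong)
    fix u assume "u \<in> U"
    then have "W \<inter> F u = F u" using assms(3) by auto
    then show "sum m (F u) = (\<Sum>v\<in>W. if v \<in> F u then m v else 0)"
      using assms(2) by (subst sum.inter_restrict[symmetric]) auto
  qed simp
  also have "\<dots> = (\<Sum>v\<in>W. \<Sum>u\<in>U. if v \<in> F u then m v else 0)" by (rule sum.swap)
  also have "\<dots> = (\<Sum>v\<in>W. card {u \<in> U. v \<in> F u} * m v)"
    using assms(1) by (intro sum.cong) (auto simp flip: sum.inter_filter)
  also have "\<dots> \<le> (\<Sum>v\<in>W. C * m v)"
    using assms(4) mult by (intro sum_mono mult_right_mono) auto
  finally show ?thesis by (simp add: sum_distrib_left)
qed

text \<open>In the application \<open>m v\<close> is \<open>\<omega> v x\<close>, \<open>p v\<close>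
  is \<open>hat_op M T v p x\<close>, and \<open>A\<close> consists of bad centres in one orbit,
  each with its own scale. The selected boxes cover \<open>A\<close>, which bounds its mass by
  theirs, and have bounded overlap, which bounds their total \<open>p\<close>-sum by that of
  \<open>W\<close>.\<close>

lemma maximal_counting:
  fixes m p :: "int ^ 'd \<Rightarrow> real" and b :: "nat \<Rightarrow> 'd \<Rightarrow> int"
  assumes mono: "mono b" and nonneg: "\<And>n j. 0 \<le> b n j"
    and fin: "finite A" "finite W" and m: "\<And>v. 0 \<le> m v" and p: "\<And>v. 0 \<le> p v" and \<epsilon>: "0 \<le> \<epsilon>"
    and bad: "\<And>u. u \<in> A \<Longrightarrow> \<epsilon> * sum m (int_box (b (n u)) u) \<le> sum p (int_box (b (n u)) u)"
    and W: "\<And>u. u \<in> A \<Longrightarrow> int_box (b (n u)) u \<subseteq> W"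
  shows "\<epsilon> * sum m A \<le> 2 ^ CARD('d) * sum p W"
proof -
  obtain U where U: "U \<subseteq> A" "A \<subseteq> (\<Union>u\<in>U. int_box (b (n u)) u)"
    "\<And>v. card {u \<in> U. v \<in> int_box (b (n u)) u} \<le> 2 ^ CARD('d)"
    by (rule box_covering[where b = b and n = n, OF mono fin(1) nonneg]) (rule that)
  have finU: "finite U" using U(1) fin(1) by (rule finite_subset)
  have "\<epsilon> * sum m A \<le> \<epsilon> * (\<Sum>u\<in>U. sum m (int_box (b (n u)) u))"
    using sum_UNION_le[where m = m, OF finU _ m U(2)] finite_int_box \<epsilon> by (intro mult_left_mono) auto
  also have "\<dots> \<le> (\<Sum>u\<in>U. sum p (int_box (b (n u)) u))"
    using bad U(1) by (subst sum_distrib_left) (intro sum_mono, auto)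
  also have "\<dots> \<le> 2 ^ CARD('d) * sum p W"
    using sum_multiplicity_le[where m = p, OF finU fin(2) _ p U(3)] W U(1) by auto
  finally show ?thesis .
qed

section \<open>Faces and the hyperplanes that contain them\<close>

text \<open>The offset \<open>t\<close> is free because slices parallel to a true face and at
  bounded distance from it are needed too.\<close>

definition face :: "('d \<Rightarrow> int) \<Rightarrow> 'd \<Rightarrow> int \<Rightarrow> int ^ 'd \<Rightarrow> (int ^ 'd) set" where
  "face r i t u = {v \<in> int_box r u. v $ i = u $ i + t}"

lemma face_subset_int_box: "face r i t u \<subseteq> int_box r u"
  by (auto simp: face_def)

lemma finite_face: "finite (face r i t u)"
  using face_subset_int_box finite_int_box by (rule finite_subset)

lemma face_translate: "face r i t u = (\<lambda>v. v + u) ` face r i t 0"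
proof -
  have "face r i t u = (\<lambda>v. v + u) ` int_box r 0 \<inter> {v. v $ i = u $ i + t}"
    unfolding face_def int_box_translate[of r u] by auto
  also have "\<dots> = (\<lambda>v. v + u) ` face r i t 0" by (auto simp: face_def)
  finally show ?thesis .
qed

text \<open>This is the corner of the small box in the orthant of \<open>u\<close> as seen from
  \<open>w\<close>. In each coordinate it overshoots \<open>u\<close> by at most \<open>R l\<close>,
  and it falls short by at most \<open>r l\<close> because the boxes meet.\<close>

lemma box_contains_corner:
  assumes v: "v \<in> int_box r u" "v \<in> int_box R w" and le: "\<And>l. R l \<le> r l"
  shows "(\<chi> l. w $ l + (if w $ l \<le> u $ l then R l else - R l)) \<in> int_box r u"
  unfolding mem_int_box
proof
  fix l
  have "\<bar>v $ l - u $ l\<bar> \<le> r l" "\<bar>v $ l - w $ l\<bar> \<le> R l" "R l \<le> r l" using v le by (auto simp: mem_int_box)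
  then show "\<bar>(\<chi> l. w $ l + (if w $ l \<le> u $ l then R l else - R l)) $ l - u $ l\<bar> \<le> r l" by auto
qed

text \<open>The small box has \<open>2 ^ CARD('d)\<close> corners, each in at most \<open>C\<close>
  boxes of the family. The bound is independent of all radii.\<close>

lemma card_boxes_meeting_smaller_box:
  fixes r :: "int ^ 'd \<Rightarrow> 'd \<Rightarrow> int"
  assumes "finite U" and mult: "\<And>v. card {u \<in> U. v \<in> int_box (r u) u} \<le> C"
    and le: "\<And>u l. u \<in> U \<Longrightarrow> R l \<le> r u l"
  shows "card {u \<in> U. int_box (r u) u \<inter> int_box R w \<noteq> {}} \<le> 2 ^ CARD('d) * C"
proof -
  define c where "c S = (\<chi> l. w $ l + (if l \<in> S then R l else - R l))" for S
  have "{u \<in> U. int_box (r u) u \<inter> int_box R w \<noteq> {}} \<subseteq> (\<Union>S\<in>UNIV. {u \<in> U. c S \<in> int_box (r u) u})"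
  proof
    fix u assume u: "u \<in> {u \<in> U. int_box (r u) u \<inter> int_box R w \<noteq> {}}"
    then obtain v where "v \<in> int_box (r u) u" "v \<in> int_box R w" by auto
    from box_contains_corner[OF this] le u have "c {l. w $ l \<le> u $ l} \<in> int_box (r u) u"
      by (simp add: c_def)
    then show "u \<in> (\<Union>S\<in>UNIV. {u \<in> U. c S \<in> int_box (r u) u})" using u by auto
  qed
  then have "card {u \<in> U. int_box (r u) u \<inter> int_box R w \<noteq> {}} \<le> card (\<Union>S\<in>UNIV. {u \<in> U. c S \<in> int_box (r u) u})"
    using \<open>finite U\<close> by (intro card_mono) auto
  also have "\<dots> \<le> (\<Sum>S\<in>UNIV. card {u \<in> U. c S \<in> int_box (r u) u})"
    by (rule card_UN_le) auto
  also have "\<dots> \<le> (\<Sum>S\<in>(UNIV :: 'd set set). C)" using mult by (intro sum_mono)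
  also have "\<dots> = 2 ^ CARD('d) * C" by (simp flip: Pow_UNIV add: card_Pow)
  finally show ?thesis .
qed

text \<open>The scales \<open>s u k q\<close> decrease with the level \<open>k\<close>, while \<open>q\<close> ranges over the candidates at one level.
  There are more candidates than values \<open>v $ i\<close> on the faces used at earlier levels near \<open>u\<close>.\<close>

lemma face_counting:
  fixes m :: "int ^ 'd \<Rightarrow> real" and b :: "nat \<Rightarrow> 'd \<Rightarrow> int" and \<epsilon> :: real and L Q :: nat
    and s :: "int ^ 'd \<Rightarrow> nat \<Rightarrow> nat \<Rightarrow> nat"
  assumes mono: "mono b" and nonneg: "\<And>n j. 0 \<le> b n j"
    and fin: "finite A" "finite W" and m: "\<And>v. 0 \<le> m v" and \<epsilon>: "0 \<le> \<epsilon>"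
    and s_le: "\<And>u k q. u \<in> A \<Longrightarrow> k < L \<Longrightarrow> q < Q \<Longrightarrow> s u k q \<le> c k"
    and s_ge: "\<And>u k k' q. u \<in> A \<Longrightarrow> k < k' \<Longrightarrow> k' < L \<Longrightarrow> q < Q \<Longrightarrow> c k' \<le> s u k q"
    and inj: "\<And>u k. u \<in> A \<Longrightarrow> k < L \<Longrightarrow> inj_on (\<lambda>q. g (s u k q)) {..<Q}"
    and Q: "L * 4 ^ CARD('d) < Q"
    and bad: "\<And>u k q. u \<in> A \<Longrightarrow> k < L \<Longrightarrow> q < Q \<Longrightarrow>
      \<epsilon> * sum m (int_box (b (s u k q)) u) \<le> sum m (face (b (s u k q)) i (g (s u k q)) u)"
    and W: "\<And>u k q. u \<in> A \<Longrightarrow> k < L \<Longrightarrow> q < Q \<Longrightarrow> int_box (b (s u k q)) u \<subseteq> W"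
  shows "real L * \<epsilon> * sum m A \<le> 2 ^ CARD('d) * sum m W"
proof -
  \<comment> \<open>\<open>D\<close> collects the faces used at the first \<open>k\<close> levels.
    The second invariant counts hyperplanes: a box no larger than any candidate of those levels
    meets \<open>D\<close> in at most \<open>k * 4 ^ CARD('d)\<close> values of coordinate
    \<open>i\<close>.\<close>
  have "\<exists>D\<subseteq>W. real k * \<epsilon> * sum m A \<le> 2 ^ CARD('d) * sum m D \<and>
    (\<forall>w R. (\<forall>u\<in>A. \<forall>j<k. \<forall>q<Q. \<forall>l. R l \<le> b (s u j q) l) \<longrightarrow>
       card ((\<lambda>v. v $ i) ` (D \<inter> int_box R w)) \<le> k * 4 ^ CARD('d))" if "k \<le> L" for k
    using that
  proof (induction k)
    case 0
    then show ?case by (intro exI[of _ "{}"]) auto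
  next
    case (Suc k)
    then have kL: "k < L" by simp
    from Suc.IH[OF less_imp_le[OF kL]] obtain D where
      D: "D \<subseteq> W" "real k * \<epsilon> * sum m A \<le> 2 ^ CARD('d) * sum m D"
      and D': "\<forall>w R. (\<forall>u\<in>A. \<forall>j<k. \<forall>q<Q. \<forall>l. R l \<le> b (s u j q) l) \<longrightarrow>
         card ((\<lambda>v. v $ i) ` (D \<inter> int_box R w)) \<le> k * 4 ^ CARD('d)"
      by (elim exE conjE) (rule that)
    have sheets: "card ((\<lambda>v. v $ i) ` (D \<inter> int_box R w)) \<le> k * 4 ^ CARD('d)"
      if "\<And>u j q l. u \<in> A \<Longrightarrow> j < k \<Longrightarrow> q < Q \<Longrightarrow> R l \<le> b (s u j q) l" for w R
      using D' that by simp
    have finD: "finite D" using D(1) fin(2) by (rule finite_subset)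
    \<comment> \<open>Pigeonhole: the box of scale \<open>c k\<close> contains every candidate box
      of level \<open>k\<close>, yet is small enough for the invariant, and the \<open>Q\<close>
      candidates lie in distinct hyperplanes.\<close>
    have "\<exists>q<Q. u $ i + g (s u k q) \<notin> (\<lambda>v. v $ i) ` (D \<inter> int_box (b (c k)) u)" if u: "u \<in> A" for u
    proof (rule ccontr)
      assume "\<not> ?thesis"
      then have "(\<lambda>q. u $ i + g (s u k q)) ` {..<Q} \<subseteq> (\<lambda>v. v $ i) ` (D \<inter> int_box (b (c k)) u)" by auto
      moreover have "inj_on (\<lambda>q. u $ i + g (s u k q)) {..<Q}"
        using inj[OF u kL] by (auto simp: inj_on_def)
      ultimately have "card {..<Q} \<le> card ((\<lambda>v. v $ i) ` (D \<inter> int_box (b (c k)) u))"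
        using finD by (intro card_inj_on_le) auto
      also have "\<dots> \<le> k * 4 ^ CARD('d)"
        using s_ge kL by (intro sheets le_funD[OF monoD[OF mono]]) auto
      also have "\<dots> \<le> L * 4 ^ CARD('d)" using kL by simp
      finally show False using Q by simp
    qed
    then obtain q where q: "\<And>u. u \<in> A \<Longrightarrow> q u < Q"
      "\<And>u. u \<in> A \<Longrightarrow> u $ i + g (s u k (q u)) \<notin> (\<lambda>v. v $ i) ` (D \<inter> int_box (b (c k)) u)" by metis
    define n where "n u = s u k (q u)" for u
    define F where "F u = face (b (n u)) i (g (n u)) u" for u
    obtain U where U: "U \<subseteq> A" "A \<subseteq> (\<Union>u\<in>U. int_box (b (n u)) u)"
      "\<And>v. card {u \<in> U. v \<in> int_box (b (n u)) u} \<le> 2 ^ CARD('d)"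
      by (rule box_covering[where b = b and n = n, OF mono fin(1) nonneg]) (rule that)
    have finU: "finite U" using U(1) fin(1) by (rule finite_subset)
    have FW: "F u \<subseteq> W" if "u \<in> A" for u
      using W[OF that kL q(1)[OF that]] face_subset_int_box unfolding F_def n_def by blast
    have disj: "D \<inter> F u = {}" if "u \<in> A" for u
    proof -
      have "int_box (b (n u)) u \<subseteq> int_box (b (c k)) u"
        unfolding n_def using that kL q(1) by (intro int_box_mono monoD[OF mono] s_le)
      then have "v \<in> int_box (b (c k)) u \<and> v $ i = u $ i + g (n u)" if "v \<in> F u" for v
        using that by (auto simp: F_def face_def)
      then show ?thesis using q(2)[OF that] unfolding n_def by (metis Int_iff disjoint_iff image_eqI)
    qed
    let ?D = "D \<union> (\<Union>u\<in>U. F u)"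
    have finF: "finite (\<Union>u\<in>U. F u)" using finU by (simp add: F_def finite_face)
    have "\<epsilon> * sum m A \<le> \<epsilon> * (\<Sum>u\<in>U. sum m (int_box (b (n u)) u))"
      using sum_UNION_le[where m = m, OF finU _ m U(2)] finite_int_box \<epsilon> by (intro mult_left_mono) auto
    also have "\<dots> \<le> (\<Sum>u\<in>U. sum m (F u))"
      unfolding F_def n_def using bad kL q(1) U(1) by (subst sum_distrib_left) (intro sum_mono, auto)
    also have "\<dots> \<le> (2 ^ CARD('d) :: nat) * sum m (\<Union>u\<in>U. F u)"
    proof (intro sum_multiplicity_le finU finF m)
      fix v
      have "card {u \<in> U. v \<in> F u} \<le> card {u \<in> U. v \<in> int_box (b (n u)) u}"
        using finU face_subset_int_box[of "b (n _)" i "g (n _)"] unfolding F_def by (intro card_mono) auto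
      then show "card {u \<in> U. v \<in> F u} \<le> 2 ^ CARD('d)" using U(3)[of v] by linarith
    qed auto
    also have "\<dots> = 2 ^ CARD('d) * sum m (\<Union>u\<in>U. F u)" by simp
    finally have new: "\<epsilon> * sum m A \<le> 2 ^ CARD('d) * sum m (\<Union>u\<in>U. F u)" .
    have "sum m ?D = sum m D + sum m (\<Union>u\<in>U. F u)"
      using finD finF disj U(1) by (intro sum.union_disjoint) auto
    then have mass: "real (Suc k) * \<epsilon> * sum m A \<le> 2 ^ CARD('d) * sum m ?D"
      using D(2) new by (simp add: algebra_simps)
    \<comment> \<open>Each selected box adds at most one hyperplane, and only if it meets
      \<open>int_box R w\<close>. Corners times multiplicity gives at most
      \<open>4 ^ CARD('d)\<close> new ones.\<close>
    have sheets': "card ((\<lambda>v. v $ i) ` (?D \<inter> int_box R w)) \<le> Suc k * 4 ^ CARD('d)"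
      if R: "\<forall>u\<in>A. \<forall>j<Suc k. \<forall>q<Q. \<forall>l. R l \<le> b (s u j q) l" for w R
    proof -
      let ?V = "{u \<in> U. int_box (b (n u)) u \<inter> int_box R w \<noteq> {}}"
      have "(\<lambda>v. v $ i) ` (?D \<inter> int_box R w) \<subseteq>
          (\<lambda>v. v $ i) ` (D \<inter> int_box R w) \<union> (\<lambda>u. u $ i + g (n u)) ` ?V"
        unfolding F_def face_def by auto
      then have "card ((\<lambda>v. v $ i) ` (?D \<inter> int_box R w)) \<le>
          card ((\<lambda>v. v $ i) ` (D \<inter> int_box R w) \<union> (\<lambda>u. u $ i + g (n u)) ` ?V)"
        using finD finU by (intro card_mono) auto
      also have "\<dots> \<le> card ((\<lambda>v. v $ i) ` (D \<inter> int_box R w)) + card ((\<lambda>u. u $ i + g (n u)) ` ?V)"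
        by (rule card_Un_le)
      also have "\<dots> \<le> k * 4 ^ CARD('d) + card ?V"
        using R finU by (intro add_mono sheets card_image_le) auto
      also have "card ?V \<le> 2 ^ CARD('d) * 2 ^ CARD('d)"
        using R q(1) U(1) finU by (intro card_boxes_meeting_smaller_box U(3)) (auto simp: n_def)
      also have "\<dots> = 4 ^ CARD('d)" by (simp flip: power_mult_distrib)
      finally show ?thesis by simp
    qed
    show ?case
    proof (intro exI[of _ ?D] conjI allI impI)
      show "?D \<subseteq> W" using D(1) FW U(1) by auto
    qed (rule mass, rule sheets')
  qed
  from this[OF order_refl] obtain D where D: "D \<subseteq> W" "real L * \<epsilon> * sum m A \<le> 2 ^ CARD('d) * sum m D"
    by (elim exE conjE) (rule that)
  have "sum m D \<le> sum m W" using D(1) fin(2) m by (intro sum_mono2) auto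
  then have "2 ^ CARD('d) * sum m D \<le> 2 ^ CARD('d) * sum m W" by (intro mult_left_mono) auto
  then show ?thesis using D(2) by linarith
qed

text \<open>The number of slices depends on \<open>c\<close> and the dimension but not on
  \<open>r\<close>, so smallness of single slices passes to the whole shell.\<close>

lemma int_box_boundary_subset:
  fixes r :: "'d::finite \<Rightarrow> int" and c :: int
  shows "{v \<in> int_box (\<lambda>j. r j + c) 0. \<exists>i. r i - c \<le> \<bar>v $ i\<bar>} \<subseteq>
    (\<Union>(i, t)\<in>UNIV \<times> {- c..c}. face (\<lambda>j. r j + c) i (r i + t) 0 \<union> face (\<lambda>j. r j + c) i (- (r i + t)) 0)"
proof
  fix v assume v: "v \<in> {v \<in> int_box (\<lambda>j. r j + c) 0. \<exists>i. r i - c \<le> \<bar>v $ i\<bar>}"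
  then obtain i where i: "r i - c \<le> \<bar>v $ i\<bar>" by auto
  have "\<bar>v $ i\<bar> \<le> r i + c" using v by (simp add: mem_int_box)
  then have "\<bar>v $ i\<bar> - r i \<in> {- c..c}" using i by simp
  moreover have "v \<in> face (\<lambda>j. r j + c) i (r i + (\<bar>v $ i\<bar> - r i)) 0 \<union>
      face (\<lambda>j. r j + c) i (- (r i + (\<bar>v $ i\<bar> - r i))) 0"
    using v by (auto simp: face_def)
  ultimately show "v \<in> (\<Union>(i, t)\<in>UNIV \<times> {- c..c}.
      face (\<lambda>j. r j + c) i (r i + t) 0 \<union> face (\<lambda>j. r j + c) i (- (r i + t)) 0)"
    by blast
qed

section \<open>Limits and projections in function spaces\<close>

lemma AE_tendsto_0I:
  fixes X :: "nat \<Rightarrow> 'a \<Rightarrow> real"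
  assumes "\<And>\<epsilon>. 0 < \<epsilon> \<Longrightarrow> AE x in M. eventually (\<lambda>n. \<bar>X n x\<bar> \<le> \<epsilon>) sequentially"
  shows "AE x in M. (\<lambda>n. X n x) \<longlonglongrightarrow> 0"
proof -
  have "AE x in M. \<forall>k. eventually (\<lambda>n. \<bar>X n x\<bar> \<le> 1 / real (Suc k)) sequentially"
    unfolding AE_all_countable using assms by simp
  then show ?thesis
  proof eventually_elim
    case (elim x)
    show ?case
    proof (rule tendstoI)
      fix e :: real assume "0 < e"
      then obtain k where "1 / real (Suc k) < e" using nat_approx_posE by blast
      with elim[rule_format, of k] show "eventually (\<lambda>n. dist (X n x) 0 < e) sequentially"
        by (auto elim: eventually_mono)
    qed
  qed
qed

lemma integrable_square_add:
  fixes f g :: "'a \<Rightarrow> real"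
  assumes [measurable]: "f \<in> borel_measurable M" "g \<in> borel_measurable M"
    and f: "integrable M (\<lambda>x. (f x)\<^sup>2)" and g: "integrable M (\<lambda>x. (g x)\<^sup>2)"
  shows "integrable M (\<lambda>x. (f x + g x)\<^sup>2)"
proof (rule Bochner_Integration.integrable_bound)
  show "integrable M (\<lambda>x. 2 * (f x)\<^sup>2 + 2 * (g x)\<^sup>2)" using f g by auto
  have "(f x + g x)\<^sup>2 \<le> 2 * (f x)\<^sup>2 + 2 * (g x)\<^sup>2" for x
    using zero_le_power2[of "f x - g x"] by (simp add: power2_eq_square algebra_simps)
  then show "AE x in M. norm ((f x + g x)\<^sup>2) \<le> norm (2 * (f x)\<^sup>2 + 2 * (g x)\<^sup>2)" by auto
qed simp

text \<open>Completeness of L1 for fast Cauchy sequences: the telescoping series converges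
  absolutely almost everywhere because the sum of its absolute values has finite integral, and
  \<open>2 * G\<close> dominates the error.\<close>

lemma L1_limit_of_summable_increments:
  fixes k :: "nat \<Rightarrow> 'a \<Rightarrow> real"
  assumes int: "\<And>n. integrable M (k n)"
    and sum: "summable (\<lambda>n. \<integral>x. \<bar>k (Suc n) x - k n x\<bar> \<partial>M)"
  obtains l where "integrable M l" "(\<lambda>n. \<integral>x. \<bar>k n x - l x\<bar> \<partial>M) \<longlonglongrightarrow> 0"
proof -
  let ?d = "\<lambda>n x. k (Suc n) x - k n x"
  have [measurable]: "k n \<in> borel_measurable M" for n using int by simp
  have intd: "integrable M (\<lambda>x. \<bar>?d n x\<bar>)" for n using int by auto
  have "(\<integral>\<^sup>+x. (\<Sum>n. ennreal \<bar>?d n x\<bar>) \<partial>M) = (\<Sum>n. \<integral>\<^sup>+x. ennreal \<bar>?d n x\<bar> \<partial>M)"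
    by (rule nn_integral_suminf) simp
  also have "\<dots> = (\<Sum>n. ennreal (\<integral>x. \<bar>?d n x\<bar> \<partial>M))"
    using intd by (intro suminf_cong nn_integral_eq_integral) auto
  also have "\<dots> = ennreal (\<Sum>n. \<integral>x. \<bar>?d n x\<bar> \<partial>M)"
    using sum by (intro suminf_ennreal2) auto
  also have "\<dots> < \<infinity>" by simp
  finally have "AE x in M. (\<Sum>n. ennreal \<bar>?d n x\<bar>) \<noteq> \<infinity>"
    by (intro nn_integral_PInf_AE) auto
  then have summable: "AE x in M. summable (\<lambda>n. \<bar>?d n x\<bar>)"
    by eventually_elim (rule summable_suminf_not_top, auto)
  define G where "G x = \<bar>k 0 x\<bar> + (\<Sum>n. \<bar>?d n x\<bar>)" for x
  define l where "l x = k 0 x + (\<Sum>n. ?d n x)" for x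
  have G: "integrable M G"
    unfolding G_def using int summable sum intd
    by (intro Bochner_Integration.integrable_add integrable_suminf) auto
  have l: "integrable M l"
    unfolding l_def using int summable sum
    by (intro Bochner_Integration.integrable_add integrable_suminf) auto
  have "AE x in M. (\<lambda>n. k n x) \<longlonglongrightarrow> l x \<and> (\<forall>n. \<bar>k n x - l x\<bar> \<le> 2 * G x)"
    using summable
  proof eventually_elim
    case (elim x)
    have k: "k n x = k 0 x + (\<Sum>j<n. ?d j x)" for n
      by (induction n) auto
    have "(\<lambda>n. k 0 x + (\<Sum>j<n. ?d j x)) \<longlonglongrightarrow> l x"
      unfolding l_def using summable_LIMSEQ[OF summable_rabs_cancel[OF elim]] by (intro tendsto_add tendsto_const)
    then have "(\<lambda>n. k n x) \<longlonglongrightarrow> l x" by (simp flip: k)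
    moreover have "\<bar>k n x - l x\<bar> \<le> 2 * G x" for n
    proof -
      have "\<bar>\<Sum>j<n. ?d j x\<bar> \<le> (\<Sum>j<n. \<bar>?d j x\<bar>)" by (rule sum_abs)
      also have "\<dots> \<le> (\<Sum>n. \<bar>?d n x\<bar>)" using elim by (intro sum_le_suminf) auto
      finally have "\<bar>k n x\<bar> \<le> G x" unfolding G_def using k[of n] by linarith
      moreover have "\<bar>l x\<bar> \<le> G x"
        unfolding G_def l_def using summable_rabs[OF elim] by linarith
      ultimately show ?thesis by linarith
    qed
    ultimately show ?case by blast
  qed
  note bound = this
  have "(\<lambda>n. \<integral>x. \<bar>k n x - l x\<bar> \<partial>M) \<longlonglongrightarrow> (\<integral>x. 0 \<partial>M)"
  proof (rule integral_dominated_convergence[where w = "\<lambda>x. 2 * G x"])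
    show "AE x in M. (\<lambda>n. \<bar>k n x - l x\<bar>) \<longlonglongrightarrow> 0"
      using bound by eventually_elim (intro tendsto_rabs_zero LIM_zero, blast)
    show "AE x in M. norm \<bar>k n x - l x\<bar> \<le> 2 * G x" for n
      using bound by eventually_elim simp
  qed (use G l in auto)
  then show thesis using l by (intro that) auto
qed

text \<open>The orthogonal projection of \<open>\<phi>\<close> to the closure of \<open>K\<close> in \<open>L\<^sup>2\<close>, without a type of \<open>L\<^sup>2\<close> functions:
  a minimising sequence is Cauchy by the parallelogram identity, and it is enough to know its limit in \<open>L\<^sup>1\<close>.\<close>

lemma (in prob_space) L2_projection:
  fixes K :: "('a \<Rightarrow> real) set"
  assumes K0: "(\<lambda>_. 0) \<in> K"
    and Kadd: "\<And>f g. f \<in> K \<Longrightarrow> g \<in> K \<Longrightarrow> (\<lambda>x. f x + g x) \<in> K"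
    and Kcmult: "\<And>c f. f \<in> K \<Longrightarrow> (\<lambda>x. c * f x) \<in> K"
    and Kmeas: "\<And>f. f \<in> K \<Longrightarrow> f \<in> borel_measurable M"
    and Ksq: "\<And>f. f \<in> K \<Longrightarrow> integrable M (\<lambda>x. (f x)\<^sup>2)"
    and [measurable]: "\<phi> \<in> borel_measurable M" and \<phi>: "integrable M (\<lambda>x. (\<phi> x)\<^sup>2)"
  obtains k l where "\<And>n :: nat. k n \<in> K" "integrable M l" "(\<lambda>n. \<integral>x. \<bar>k n x - l x\<bar> \<partial>M) \<longlonglongrightarrow> 0"
    "\<And>h C. h \<in> K \<Longrightarrow> AE x in M. \<bar>h x\<bar> \<le> C \<Longrightarrow> (\<integral>x. (\<phi> x - l x) * h x \<partial>M) = 0"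
proof -
  define N where "N f = (\<integral>x. (\<phi> x - f x)\<^sup>2 \<partial>M)" for f
  define I where "I = (INF f\<in>K. N f)"
  have bdd: "bdd_below (N ` K)" by (auto simp: N_def intro!: bdd_belowI2[where m = 0])
  have I_le: "I \<le> N f" if "f \<in> K" for f
    unfolding I_def using bdd that by (rule cINF_lower)
  have sq: "integrable M (\<lambda>x. (\<phi> x - f x)\<^sup>2)" if "f \<in> K" for f
    using integrable_square_add[of \<phi> M "\<lambda>x. - f x"] Kmeas[OF that] Ksq[OF that] \<phi> by simp
  \<comment> \<open>The tolerance \<open>(1 / 4) ^ n\<close> makes the L2 increments of order
    \<open>(1 / 2) ^ n\<close>, hence summable.\<close>
  have "\<exists>f\<in>K. N f < I + (1 / 4) ^ n" for n
    using cInf_lessD[of "N ` K" "I + (1 / 4) ^ n"] K0 unfolding I_def by auto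
  then have "\<exists>k. \<forall>n. k n \<in> K \<and> N (k n) < I + (1 / 4) ^ n" by (intro choice) blast
  then obtain k where k: "\<And>n. k n \<in> K" "\<And>n. N (k n) < I + (1 / 4) ^ n" by blast
  have [measurable]: "k n \<in> borel_measurable M" for n using Kmeas k(1) by blast
  have intk: "integrable M (k n)" for n 
    by (rule square_integrable_imp_integrable[OF Kmeas[OF k(1)] Ksq[OF k(1)]])
  have incr: "(\<integral>x. \<bar>k (Suc n) x - k n x\<bar> \<partial>M) \<le> 5 / 2 * (1 / 2) ^ n" for n
  proof -
    let ?d = "\<lambda>x. k (Suc n) x - k n x" and ?a = "\<lambda>x. 1 / 2 * (k (Suc n) x + k n x)"
    have a: "?a \<in> K" using k(1) by (intro Kcmult Kadd)
    define A where "A = N ?a"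
    have "(1 / 4) ^ Suc n \<le> (1 / 4 :: real) ^ n" by simp
    then have k': "N (k (Suc n)) < I + (1 / 4) ^ n"
      by (intro less_le_trans[OF k(2)] add_left_mono)
    have A: "I \<le> A" unfolding A_def using a by (rule I_le)
    have dsq: "integrable M (\<lambda>x. (?d x)\<^sup>2)"
      using integrable_square_add[of "k (Suc n)" M "\<lambda>x. - k n x"] Ksq[OF k(1)] by simp
    \<comment> \<open>The midpoint \<open>?a\<close> belongs to \<open>K\<close>, so
      \<open>A\<close> is at least \<open>I\<close>; in the resulting bound the multiples of
      \<open>I\<close> cancel.\<close>
    have "(\<integral>x. (?d x)\<^sup>2 \<partial>M) = (\<integral>x. 2 * (\<phi> x - k (Suc n) x)\<^sup>2 + 2 * (\<phi> x - k n x)\<^sup>2 - 4 * (\<phi> x - ?a x)\<^sup>2 \<partial>M)"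
      by (intro Bochner_Integration.integral_cong) (auto simp: power2_eq_square field_simps)
    also have "\<dots> = 2 * N (k (Suc n)) + 2 * N (k n) - 4 * A"
      unfolding A_def N_def using sq[OF k(1)] sq[OF a] by simp
    also have "\<dots> \<le> 4 * (1 / 4) ^ n" using k(2)[of n] k' A by linarith
    finally have d: "(\<integral>x. (?d x)\<^sup>2 \<partial>M) \<le> 4 * (1 / 4) ^ n" .
    \<comment> \<open>In place of Cauchy-Schwarz, the inequality of means is used with a weight
      \<open>t\<close> of the expected size of the increment; it gives
      \<open>t / 2 + 2 * t\<close>.\<close>
    define t :: real where "t = (1 / 2) ^ n"
    have t: "0 < t" "(1 / 4) ^ n = t * t" by (auto simp: t_def simp flip: power_mult_distrib)
    have "\<bar>?d x\<bar> \<le> t / 2 + (?d x)\<^sup>2 / (2 * t)" for x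
    proof -
      have "2 * t * \<bar>?d x\<bar> \<le> t\<^sup>2 + (?d x)\<^sup>2"
        using zero_le_power2[of "t - \<bar>?d x\<bar>"] by (simp add: power2_diff)
      then show ?thesis using t by (simp add: field_simps power2_eq_square)
    qed
    then have "(\<integral>x. \<bar>?d x\<bar> \<partial>M) \<le> (\<integral>x. t / 2 + (?d x)\<^sup>2 / (2 * t) \<partial>M)"
      using intk dsq by (intro integral_mono) auto
    also have "\<dots> = t / 2 + (\<integral>x. (?d x)\<^sup>2 \<partial>M) / (2 * t)"
      using dsq by (simp add: prob_space)
    also have "\<dots> \<le> t / 2 + 4 * (t * t) / (2 * t)"
      using d t by (intro add_left_mono divide_right_mono) auto
    also have "\<dots> = 5 / 2 * t" using t by (simp add: field_simps)
    finally show ?thesis by (simp add: t_def)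
  qed
  have "summable (\<lambda>n. \<integral>x. \<bar>k (Suc n) x - k n x\<bar> \<partial>M)"
  proof (rule summable_comparison_test')
    show "summable (\<lambda>n. 5 / 2 * (1 / 2 :: real) ^ n)" by (intro summable_mult summable_geometric) simp
  qed (use incr in simp)
  then obtain l where l: "integrable M l" "(\<lambda>n. \<integral>x. \<bar>k n x - l x\<bar> \<partial>M) \<longlonglongrightarrow> 0"
    by (rule L1_limit_of_summable_increments[OF intk]) (rule that)
  have [measurable]: "l \<in> borel_measurable M" using l(1) by simp
  have "(\<integral>x. (\<phi> x - l x) * h x \<partial>M) = 0" if h: "h \<in> K" and C: "AE x in M. \<bar>h x\<bar> \<le> C" for h C
  proof -
    have [measurable]: "h \<in> borel_measurable M" using h by (rule Kmeas)
    \<comment> \<open>The limit \<open>l\<close> is only known to be in L1, so its products with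
      \<open>h\<close> are integrable because \<open>h\<close> is essentially bounded.\<close>
    have bd: "integrable M (\<lambda>x. f x * h x)" if f: "integrable M f" for f
    proof (rule Bochner_Integration.integrable_bound)
      show "integrable M (\<lambda>x. C * f x)" using f by simp
      show "AE x in M. norm (f x * h x) \<le> norm (C * f x)"
        using C
      proof eventually_elim
        case (elim x)
        then have "\<bar>f x\<bar> * \<bar>h x\<bar> \<le> \<bar>f x\<bar> * \<bar>C\<bar>" by (intro mult_left_mono) auto
        then show ?case by (simp add: abs_mult mult.commute)
      qed
    qed (use f in simp)
    define s where "s = (\<integral>x. (\<phi> x - l x) * h x \<partial>M)"
    define H where "H = (\<integral>x. (h x)\<^sup>2 \<partial>M)"
    have H: "0 \<le> H" by (simp add: H_def)
    have int\<phi>: "integrable M \<phi>" by (rule square_integrable_imp_integrable[OF _ \<phi>]) simp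
    let ?p = "\<lambda>n. \<integral>x. (\<phi> x - k n x) * h x \<partial>M"
    have "(\<lambda>n. ?p n - s) \<longlonglongrightarrow> 0"
    proof (rule Lim_null_comparison)
      show "(\<lambda>n. C * (\<integral>x. \<bar>k n x - l x\<bar> \<partial>M)) \<longlonglongrightarrow> 0" using l(2) by (rule tendsto_mult_right_zero)
      have "norm (?p n - s) \<le> C * (\<integral>x. \<bar>k n x - l x\<bar> \<partial>M)" for n
      proof -
        have "?p n - s = (\<integral>x. (l x - k n x) * h x \<partial>M)"
          unfolding s_def using bd[OF int\<phi>] bd[OF l(1)] bd[OF intk] by (simp add: left_diff_distrib)
        also have "norm \<dots> \<le> (\<integral>x. norm ((l x - k n x) * h x) \<partial>M)" by (rule integral_norm_bound)
        also have "\<dots> \<le> (\<integral>x. C * \<bar>k n x - l x\<bar> \<partial>M)"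
        proof (rule integral_mono_AE)
          show "integrable M (\<lambda>x. norm ((l x - k n x) * h x))"
            using bd[of "\<lambda>x. l x - k n x"] l(1) intk by (intro Bochner_Integration.integrable_norm) auto
          show "AE x in M. norm ((l x - k n x) * h x) \<le> C * \<bar>k n x - l x\<bar>"
            using C
          proof eventually_elim
            case (elim x)
            then have "\<bar>k n x - l x\<bar> * \<bar>h x\<bar> \<le> \<bar>k n x - l x\<bar> * C" by (intro mult_left_mono) auto
            then show ?case by (simp add: abs_mult mult.commute abs_minus_commute)
          qed
        qed (use l(1) intk in auto)
        finally show ?thesis by simp
      qed
      then show "eventually (\<lambda>n. norm (?p n - s) \<le> C * (\<integral>x. \<bar>k n x - l x\<bar> \<partial>M)) sequentially" by simp
    qed
    then have lim: "?p \<longlonglongrightarrow> s" by (simp add: LIM_zero_iff)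
    \<comment> \<open>First variation: moving from \<open>k n\<close> by \<open>t * h\<close> stays
      in \<open>K\<close>, so it cannot go below the infimum \<open>I\<close>, which
      \<open>k n\<close> misses by less than \<open>(1 / 4) ^ n\<close>.\<close>
    have var: "2 * t * ?p n \<le> (1 / 4) ^ n + t\<^sup>2 * H" for n t
    proof -
      have "(\<lambda>x. k n x + t * h x) \<in> K" using k(1) h by (intro Kadd Kcmult)
      then have "I \<le> (\<integral>x. (\<phi> x - (k n x + t * h x))\<^sup>2 \<partial>M)" using I_le by (simp add: N_def)
      also have "\<dots> = (\<integral>x. (\<phi> x - k n x)\<^sup>2 - 2 * t * ((\<phi> x - k n x) * h x) + t\<^sup>2 * (h x)\<^sup>2 \<partial>M)"
        by (intro Bochner_Integration.integral_cong) (auto simp: power2_eq_square algebra_simps)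
      also have "\<dots> = N (k n) - 2 * t * ?p n + t\<^sup>2 * H"
        unfolding N_def H_def using sq[OF k(1)] Ksq[OF h] bd[of "\<lambda>x. \<phi> x - k n x"] int\<phi> intk by simp
      finally show ?thesis using k(2)[of n] by linarith
    qed
    have "2 * t * s \<le> 0 + t\<^sup>2 * H" for t
    proof (rule LIMSEQ_le)
      show "(\<lambda>n. 2 * t * ?p n) \<longlonglongrightarrow> 2 * t * s" using lim by (intro tendsto_mult tendsto_const)
      show "(\<lambda>n. (1 / 4) ^ n + t\<^sup>2 * H) \<longlonglongrightarrow> 0 + t\<^sup>2 * H"
        by (intro tendsto_add tendsto_const LIMSEQ_power_zero) simp
    qed (use var in auto)
    \<comment> \<open>The optimal choice would be \<open>s / H\<close>. Adding 1 covers
      \<open>H = 0\<close> and still forces \<open>2 * s\<^sup>2 \<le> s\<^sup>2\<close>.\<close>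
    from this[of "s / (H + 1)"] have "2 * s\<^sup>2 / (H + 1) \<le> s\<^sup>2 * H / (H + 1)\<^sup>2"
      by (simp add: power2_eq_square)
    also have "\<dots> \<le> s\<^sup>2 / (H + 1)"
      using H mult_left_mono[of H "H + 1" "s\<^sup>2"] by (simp add: power2_eq_square divide_simps mult_ac)
    finally have "2 * s\<^sup>2 \<le> s\<^sup>2" using H by (auto simp: divide_le_cancel)
    then have "s\<^sup>2 \<le> 0" by linarith
    then show ?thesis by (simp add: s_def)
  qed
  with k(1) l show thesis by (rule that)
qed

section \<open>Non-singular actions\<close>

locale nonsingular = prob_space M for M :: "'x measure" +
  fixes T :: "int ^ 'd \<Rightarrow> 'x \<Rightarrow> 'x"
  assumes nonsingular: "nonsingular_action M T"
begin

abbreviation \<omega> :: "int ^ 'd \<Rightarrow> 'x \<Rightarrow> real" where "\<omega> \<equiv> omega M T"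

lemma T_measurable [measurable]: "T u \<in> measurable M M"
  using nonsingular by (simp add: nonsingular_action_def measurable_action_def)

lemma T_in_space: "x \<in> space M \<Longrightarrow> T u x \<in> space M"
  using measurable_space[OF T_measurable] .

lemma T_0: "x \<in> space M \<Longrightarrow> T 0 x = x"
  and T_add: "x \<in> space M \<Longrightarrow> T (u + v) x = T u (T v x)"
  using nonsingular by (simp_all add: nonsingular_action_def measurable_action_def)

lemma T_uminus: "x \<in> space M \<Longrightarrow> T (- u) (T u x) = x" "x \<in> space M \<Longrightarrow> T u (T (- u) x) = x"
  by (simp_all flip: T_add add: T_0)

lemma omega_measurable [measurable]: "\<omega> u \<in> borel_measurable M"
proof -
  have "\<omega> u = (\<lambda>x. enn2real (RN_deriv M (comp_measure M T u) x))" by (auto simp: omega_def)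
  then show ?thesis by simp
qed

lemma omega_nonneg [simp]: "0 \<le> \<omega> u x"
  by (simp add: omega_def)

lemma density_omega: "density M (\<lambda>x. ennreal (\<omega> u x)) = distr M M (T (- u))"
proof -
  let ?N = "comp_measure M T u"
  have ac: "absolutely_continuous M ?N" and sets: "sets ?N = sets M"
    using nonsingular by (simp_all add: nonsingular_action_def comp_measure_def)
  interpret N: prob_space ?N
    unfolding comp_measure_def by (rule prob_space_distr) simp
  \<comment> \<open>\<open>enn2real\<close> would turn an infinite value into 0; finiteness almost
    everywhere lets \<open>\<omega> u\<close> stand for the derivative.\<close>
  have "AE x in M. RN_deriv M ?N x \<noteq> \<infinity>"
    using N.sigma_finite_measure_axioms ac sets by (rule RN_deriv_finite)
  then have "AE x in M. ennreal (\<omega> u x) = RN_deriv M ?N x"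
    by eventually_elim (simp add: omega_def less_top)
  then have "density M (\<lambda>x. ennreal (\<omega> u x)) = density M (RN_deriv M ?N)"
    by (intro density_cong) simp_all
  also have "\<dots> = ?N" using ac sets by (rule density_RN_deriv)
  finally show ?thesis by (simp add: comp_measure_def)
qed

text \<open>Change of variables: weighting by \<open>\<omega> u\<close> is pushing forward along
  \<open>T (- u)\<close>, which undoes \<open>T u\<close>. This is why \<open>hat_op\<close>
  preserves integrals although the action need not preserve \<open>M\<close>.\<close>

lemma nn_integral_shift:
  assumes [measurable]: "f \<in> borel_measurable M"
  shows "(\<integral>\<^sup>+x. f (T u x) * ennreal (\<omega> u x) \<partial>M) = (\<integral>\<^sup>+x. f x \<partial>M)"
proof -
  have "(\<integral>\<^sup>+x. f (T u x) * ennreal (\<omega> u x) \<partial>M) = (\<integral>\<^sup>+x. f (T u x) \<partial>density M (\<lambda>x. ennreal (\<omega> u x)))"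
    by (simp add: nn_integral_density mult.commute)
  also have "\<dots> = (\<integral>\<^sup>+x. f (T u (T (- u) x)) \<partial>M)"
    unfolding density_omega by (simp add: nn_integral_distr)
  also have "\<dots> = (\<integral>\<^sup>+x. f x \<partial>M)" by (intro nn_integral_cong) (simp add: T_uminus)
  finally show ?thesis .
qed

lemma integrable_hat_op_iff:
  assumes [measurable]: "f \<in> borel_measurable M"
  shows "integrable M (hat_op M T u f) \<longleftrightarrow> integrable M f"
proof -
  have "integrable M (hat_op M T u f) \<longleftrightarrow> integrable M (\<lambda>x. \<omega> u x *\<^sub>R f (T u x))"
    by (simp add: hat_op_def[abs_def] mult.commute)
  also have "\<dots> \<longleftrightarrow> integrable (density M (\<lambda>x. ennreal (\<omega> u x))) (\<lambda>x. f (T u x))"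
    by (subst integrable_density) auto
  also have "\<dots> \<longleftrightarrow> integrable M (\<lambda>x. f (T u (T (- u) x)))"
    unfolding density_omega by (subst integrable_distr_eq) auto
  also have "\<dots> \<longleftrightarrow> integrable M f" by (intro Bochner_Integration.integrable_cong) (auto simp: T_uminus)
  finally show ?thesis .
qed

lemma integral_hat_op:
  assumes [measurable]: "f \<in> borel_measurable M"
  shows "(\<integral>x. hat_op M T u f x \<partial>M) = (\<integral>x. f x \<partial>M)"
proof -
  have "(\<integral>x. hat_op M T u f x \<partial>M) = (\<integral>x. \<omega> u x *\<^sub>R f (T u x) \<partial>M)"
    by (simp add: hat_op_def mult.commute)
  also have "\<dots> = (\<integral>x. f (T u x) \<partial>density M (\<lambda>x. ennreal (\<omega> u x)))"
    by (subst integral_density) auto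
  also have "\<dots> = (\<integral>x. f (T u (T (- u) x)) \<partial>M)"
    unfolding density_omega by (subst integral_distr) auto
  also have "\<dots> = (\<integral>x. f x \<partial>M)" by (intro Bochner_Integration.integral_cong) (auto simp: T_uminus)
  finally show ?thesis .
qed

lemma hat_op_measurable [measurable]:
  "f \<in> borel_measurable M \<Longrightarrow> hat_op M T u f \<in> borel_measurable M"
  unfolding hat_op_def[abs_def]
  by (intro borel_measurable_times measurable_compose[OF T_measurable] omega_measurable)

text \<open>Chain rule for Radon-Nikodym derivatives: both sides are densities of the push-forward
  along \<open>T (- (u + v))\<close>, and densities are unique almost everywhere.\<close>

lemma omega_cocycle: "AE x in M. \<omega> (u + v) x = \<omega> u (T v x) * \<omega> v x"
proof -
  have "density M (\<lambda>x. ennreal (\<omega> u (T v x) * \<omega> v x)) = density M (\<lambda>x. ennreal (\<omega> (u + v) x))"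
  proof (rule measure_eqI)
    fix A assume "A \<in> sets (density M (\<lambda>x. ennreal (\<omega> u (T v x) * \<omega> v x)))"
    then have A [measurable]: "A \<in> sets M" by simp
    have "emeasure (density M (\<lambda>x. ennreal (\<omega> u (T v x) * \<omega> v x))) A =
        (\<integral>\<^sup>+x. ennreal (\<omega> u (T v x) * \<omega> v x) * indicator A x \<partial>M)"
      by (rule emeasure_density) measurable
    \<comment> \<open>Writing \<open>x\<close> as \<open>T (- v) (T v x)\<close> in the indicator
      makes the integrand a function of \<open>T v x\<close> times \<open>\<omega> v x\<close>,
      ready for the shift by \<open>v\<close>.\<close>
    also have "\<dots> = (\<integral>\<^sup>+x. (ennreal (\<omega> u (T v x)) * indicator A (T (- v) (T v x))) * ennreal (\<omega> v x) \<partial>M)"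
      by (intro nn_integral_cong) (simp add: T_uminus ennreal_mult mult_ac)
    also have "\<dots> = (\<integral>\<^sup>+x. ennreal (\<omega> u x) * indicator A (T (- v) x) \<partial>M)"
      by (rule nn_integral_shift) measurable
    also have "\<dots> = (\<integral>\<^sup>+x. indicator A (T (- v) (T (- u) (T u x))) * ennreal (\<omega> u x) \<partial>M)"
      by (intro nn_integral_cong) (simp add: T_uminus mult_ac)
    also have "\<dots> = (\<integral>\<^sup>+x. indicator A (T (- v) (T (- u) x)) \<partial>M)"
      by (rule nn_integral_shift) measurable
    also have "\<dots> = (\<integral>\<^sup>+x. indicator A (T (- (u + v)) x) \<partial>M)"
      by (intro nn_integral_cong) (simp flip: T_add add: algebra_simps)
    also have "\<dots> = (\<integral>\<^sup>+x. indicator A x \<partial>distr M M (T (- (u + v))))"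
      by (subst nn_integral_distr) auto
    also have "\<dots> = emeasure (density M (\<lambda>x. ennreal (\<omega> (u + v) x))) A"
      by (simp add: density_omega)
    finally show "emeasure (density M (\<lambda>x. ennreal (\<omega> u (T v x) * \<omega> v x))) A =
      emeasure (density M (\<lambda>x. ennreal (\<omega> (u + v) x))) A" .
  qed simp
  then have "AE x in M. ennreal (\<omega> u (T v x) * \<omega> v x) = ennreal (\<omega> (u + v) x)"
    by (subst (asm) density_unique_iff) auto
  then show ?thesis by eventually_elim (simp add: ennreal_inj)
qed

lemma omega_0: "AE x in M. \<omega> 0 x = 1"
proof -
  have "distr M M (T (- 0)) = distr M M (\<lambda>x. x)" by (intro distr_cong) (auto simp: T_0)
  also have "\<dots> = density M (\<lambda>x. 1)" by (simp add: density_1)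
  finally have "density M (\<lambda>x. ennreal (\<omega> 0 x)) = density M (\<lambda>x. 1)" by (simp add: density_omega)
  then have "AE x in M. ennreal (\<omega> 0 x) = 1"
    by (subst (asm) density_unique_iff) auto
  then show ?thesis by eventually_elim (simp add: ennreal_eq_1)
qed

section \<open>Weighted orbit sums at regular points\<close>

text \<open>The group is countable, so one null set takes care of all cocycle identities at once,
  and the counting lemmas then apply exactly along the orbit of such a point.\<close>

definition regular_point :: "'x \<Rightarrow> bool" where
  "regular_point x \<longleftrightarrow> x \<in> space M \<and> \<omega> 0 x = 1 \<and> (\<forall>u v. \<omega> (u + v) x = \<omega> u (T v x) * \<omega> v x)"

lemma AE_regular_point: "AE x in M. regular_point x"
  unfolding regular_point_def using omega_0 omega_cocycle by (auto simp: AE_all_countable)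

definition box_sum :: "('d \<Rightarrow> int) \<Rightarrow> ('x \<Rightarrow> real) \<Rightarrow> 'x \<Rightarrow> real" where
  "box_sum r f x = (\<Sum>u\<in>int_box r 0. hat_op M T u f x)"

lemma box_sum_measurable [measurable]:
  "f \<in> borel_measurable M \<Longrightarrow> box_sum r f \<in> borel_measurable M"
  unfolding box_sum_def[abs_def] by measurable

lemma hat_op_shift:
  assumes "regular_point x"
  shows "hat_op M T v f (T u x) * \<omega> u x = hat_op M T (v + u) f x"
  using assms by (simp add: hat_op_def regular_point_def T_add)

lemma sum_hat_op_shift:
  assumes "regular_point x"
  shows "(\<Sum>v\<in>B. hat_op M T v f (T u x)) * \<omega> u x = (\<Sum>v\<in>(\<lambda>v. v + u) ` B. hat_op M T v f x)"
  by (subst sum.reindex) (auto simp: sum_distrib_right hat_op_shift[OF assms])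

text \<open>Moving the base point multiplies numerator and denominator by the same factor
  \<open>\<omega> u x\<close>, so the ratios at \<open>T u x\<close> are those of boxes centred at
  \<open>u\<close> in the orbit of \<open>x\<close>.\<close>

lemma box_sum_shift:
  assumes "regular_point x"
  shows "box_sum r f (T u x) * \<omega> u x = (\<Sum>v\<in>int_box r u. hat_op M T v f x)"
  unfolding box_sum_def int_box_translate[of r u] by (rule sum_hat_op_shift[OF assms])

lemma hat_op_1: "hat_op M T u (\<lambda>_. 1) x = \<omega> u x"
  by (simp add: hat_op_def)

lemma hat_op_nonneg: "(\<And>x. 0 \<le> f x) \<Longrightarrow> 0 \<le> hat_op M T u f x"
  by (simp add: hat_op_def)

lemma hat_op_add: "hat_op M T u (\<lambda>x. f x + g x) x = hat_op M T u f x + hat_op M T u g x"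
  and hat_op_cmult: "hat_op M T u (\<lambda>x. c * f x) x = c * hat_op M T u f x"
  by (simp_all add: hat_op_def algebra_simps)

lemma box_sum_add: "box_sum r (\<lambda>x. f x + g x) x = box_sum r f x + box_sum r g x"
  and box_sum_cmult: "box_sum r (\<lambda>x. c * f x) x = c * box_sum r f x"
  by (simp_all add: box_sum_def hat_op_add hat_op_cmult sum.distrib sum_distrib_left)

text \<open>The centre alone contributes \<open>\<omega> 0 x = 1\<close>. This keeps all
  denominators positive.\<close>

lemma box_sum_1_ge_1:
  assumes "regular_point x" and "\<And>j. 0 \<le> r j"
  shows "1 \<le> box_sum r (\<lambda>_. 1) x"
proof -
  have "(\<Sum>u\<in>{0}. \<omega> u x) \<le> (\<Sum>u\<in>int_box r 0. \<omega> u x)"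
    using assms(2) by (intro sum_mono2 finite_int_box) (auto simp: mem_int_box)
  then show ?thesis using assms(1) by (simp add: box_sum_def hat_op_1 regular_point_def)
qed

lemma abs_box_sum_le: "\<bar>box_sum r f x\<bar> \<le> box_sum r (\<lambda>x. \<bar>f x\<bar>) x"
  unfolding box_sum_def by (rule order_trans[OF sum_abs]) (simp add: hat_op_def abs_mult)

subsection \<open>The maximal inequality\<close>

text \<open>Calderon's transference: an inequality between sums along orbits over finite subsets of the
  group becomes an inequality between integrals, because cubes are asymptotically invariant.\<close>

lemma transference:
  assumes E [measurable]: "E \<in> sets M" and p: "integrable M p"
    and orbit: "AE x in M. \<forall>A W. finite A \<longrightarrow> finite W \<longrightarrow> (\<forall>u\<in>A. T u x \<in> E) \<longrightarrow>
      (\<forall>u\<in>A. int_box (\<lambda>_. int r) u \<subseteq> W) \<longrightarrow>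
      c * (\<Sum>u\<in>A. \<omega> u x) \<le> C * (\<Sum>v\<in>W. hat_op M T v p x)"
  shows "c * measure M E \<le> C * (\<integral>x. p x \<partial>M)"
proof -
  have [measurable]: "p \<in> borel_measurable M" using p by simp
  define K where "K N = int_box (\<lambda>_. int N) (0 :: int ^ 'd)" for N
  have finK: "finite (K N)" for N by (simp add: K_def finite_int_box)
  have cardK: "card (K N) = (2 * N + 1) ^ CARD('d)" for N
    unfolding K_def by (rule card_cube)
  have int: "integrable M (hat_op M T u p)" "integrable M (hat_op M T u (indicator E))" for u
    using p by (auto simp: integrable_hat_op_iff intro!: integrable_const_bound[where B = 1])
  \<comment> \<open>The orbit inequality is applied with \<open>A\<close> the visits to
    \<open>E\<close> from \<open>K N\<close> and with \<open>W = K (N + r)\<close>. After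
    integration each side is a cardinality times an integral, and the last factor is the ratio of
    the two cardinalities.\<close>
  have main: "c * measure M E \<le> (C * (\<integral>x. p x \<partial>M)) * (1 + 2 * real r / (2 * real N + 1)) ^ CARD('d)" for N
  proof -
    have "AE x in M. c * (\<Sum>u\<in>K N. hat_op M T u (indicator E) x) \<le> C * (\<Sum>v\<in>K (N + r). hat_op M T v p x)"
      using orbit
    proof eventually_elim
      case (elim x)
      let ?A = "{u \<in> K N. T u x \<in> E}"
      have eq: "(\<Sum>u\<in>K N. hat_op M T u (indicator E) x) = (\<Sum>u\<in>?A. \<omega> u x)"
        by (subst sum.inter_filter[OF finK]) (auto simp: hat_op_def intro!: sum.cong)
      have sub: "int_box (\<lambda>_. int r) u \<subseteq> K (N + r)" if "u \<in> ?A" for u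
      proof
        fix v assume v: "v \<in> int_box (\<lambda>_. int r) u"
        have "\<bar>v $ i\<bar> \<le> int (N + r)" for i
        proof -
          have "\<bar>v $ i - u $ i\<bar> \<le> int r" "\<bar>u $ i\<bar> \<le> int N" using v that by (auto simp: mem_int_box K_def)
          then show ?thesis by linarith
        qed
        then show "v \<in> K (N + r)" by (simp add: K_def mem_int_box)
      qed
      have "finite ?A" using finK by simp
      then show ?case
        unfolding eq using elim[THEN spec, THEN spec, THEN mp, THEN mp, of ?A "K (N + r)"] finK sub by blast
    qed
    then have "(\<integral>x. c * (\<Sum>u\<in>K N. hat_op M T u (indicator E) x) \<partial>M) \<le>
        (\<integral>x. C * (\<Sum>v\<in>K (N + r). hat_op M T v p x) \<partial>M)"
      using int by (intro integral_mono_AE) auto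
    then have "c * (card (K N) * measure M E) \<le> C * (card (K (N + r)) * (\<integral>x. p x \<partial>M))"
      using int by (simp add: integral_hat_op)
    then have "c * ((2 * real N + 1) ^ CARD('d) * measure M E) \<le>
        C * ((2 * (real N + real r) + 1) ^ CARD('d) * (\<integral>x. p x \<partial>M))"
      by (simp add: cardK algebra_simps)
    moreover have "2 * (real N + real r) + 1 = (2 * real N + 1) * (1 + 2 * real r / (2 * real N + 1))"
      by (simp add: field_simps)
    ultimately have "(2 * real N + 1) ^ CARD('d) * (c * measure M E) \<le> (2 * real N + 1) ^ CARD('d) *
        ((C * (\<integral>x. p x \<partial>M)) * (1 + 2 * real r / (2 * real N + 1)) ^ CARD('d))"
      by (simp only: power_mult_distrib mult_ac)
    then show ?thesis by (subst (asm) mult_le_cancel_left_pos) auto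
  qed
  have "(\<lambda>N. 2 * real r / (2 * real N + 1)) \<longlonglongrightarrow> 0"
    by (intro tendsto_divide_0[OF tendsto_const] filterlim_at_top_imp_at_infinity
        filterlim_at_top_mono[OF filterlim_real_sequentially]) auto
  then have "(\<lambda>N. (C * (\<integral>x. p x \<partial>M)) * (1 + 2 * real r / (2 * real N + 1)) ^ CARD('d)) \<longlonglongrightarrow>
      (C * (\<integral>x. p x \<partial>M)) * (1 + 0) ^ CARD('d)"
    by (intro tendsto_intros)
  then have "c * measure M E \<le> (C * (\<integral>x. p x \<partial>M)) * (1 + 0) ^ CARD('d)"
    by (rule LIMSEQ_le_const) (use main in auto)
  then show ?thesis by simp
qed

lemma maximal_inequality:
  fixes b :: "nat \<Rightarrow> 'd \<Rightarrow> int"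
  assumes mono: "mono b" and nonneg: "\<And>n j. 0 \<le> b n j"
    and p: "integrable M p" "\<And>x. 0 \<le> p x" and \<epsilon>: "0 \<le> \<epsilon>"
  shows "\<epsilon> * measure M {x \<in> space M. \<exists>n. \<epsilon> * box_sum (b n) (\<lambda>_. 1) x < box_sum (b n) p x}
    \<le> 2 ^ CARD('d) * (\<integral>x. p x \<partial>M)"
proof -
  have [measurable]: "p \<in> borel_measurable M" using p by simp
  \<comment> \<open>Transference needs one radius for all boxes involved, hence the truncation at
    \<open>N\<close>; it is removed at the end by continuity of the measure.\<close>
  define E where "E N = {x \<in> space M. \<exists>n\<le>N. \<epsilon> * box_sum (b n) (\<lambda>_. 1) x < box_sum (b n) p x}" for N
  have E [measurable]: "E N \<in> sets M" for N unfolding E_def by measurable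
  have "\<epsilon> * measure M (E N) \<le> 2 ^ CARD('d) * (\<integral>x. p x \<partial>M)" for N
  \<comment> \<open>The sum of the half-sides is a common bound for each of them.\<close>
  proof (rule transference[where r = "nat (\<Sum>j\<in>UNIV. b N j)", OF E p(1)])
    show "AE x in M. \<forall>A W. finite A \<longrightarrow> finite W \<longrightarrow> (\<forall>u\<in>A. T u x \<in> E N) \<longrightarrow>
      (\<forall>u\<in>A. int_box (\<lambda>_. int (nat (\<Sum>j\<in>UNIV. b N j))) u \<subseteq> W) \<longrightarrow>
      \<epsilon> * (\<Sum>u\<in>A. \<omega> u x) \<le> 2 ^ CARD('d) * (\<Sum>v\<in>W. hat_op M T v p x)"
      using AE_regular_point
    proof (eventually_elim, intro allI impI)
      fix x A W assume x: "regular_point x" and fin: "finite A" "finite W"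
        and A: "\<forall>u\<in>A. T u x \<in> E N" and W: "\<forall>u\<in>A. int_box (\<lambda>_. int (nat (\<Sum>j\<in>UNIV. b N j))) u \<subseteq> W"
      have "\<forall>u\<in>A. \<exists>n\<le>N. \<epsilon> * box_sum (b n) (\<lambda>_. 1) (T u x) < box_sum (b n) p (T u x)"
        using A by (auto simp: E_def)
      then obtain n where n: "\<And>u. u \<in> A \<Longrightarrow> n u \<le> N"
        "\<And>u. u \<in> A \<Longrightarrow> \<epsilon> * box_sum (b (n u)) (\<lambda>_. 1) (T u x) < box_sum (b (n u)) p (T u x)" by metis
      show "\<epsilon> * (\<Sum>u\<in>A. \<omega> u x) \<le> 2 ^ CARD('d) * (\<Sum>v\<in>W. hat_op M T v p x)"
      proof (rule maximal_counting[where b = b and n = n])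
        fix u assume u: "u \<in> A"
        have "\<epsilon> * box_sum (b (n u)) (\<lambda>_. 1) (T u x) * \<omega> u x \<le> box_sum (b (n u)) p (T u x) * \<omega> u x"
          using n(2)[OF u] by (intro mult_right_mono) auto
        then show "\<epsilon> * (\<Sum>v\<in>int_box (b (n u)) u. \<omega> v x) \<le> (\<Sum>v\<in>int_box (b (n u)) u. hat_op M T v p x)"
          by (simp add: box_sum_shift[OF x] mult.assoc hat_op_1)
        have "b (n u) j \<le> int (nat (\<Sum>j\<in>UNIV. b N j))" for j
        proof -
          have "b (n u) j \<le> b N j" using n(1)[OF u] mono by (metis le_funD monoD)
          also have "\<dots> \<le> (\<Sum>j\<in>UNIV. b N j)" using nonneg by (intro member_le_sum) auto
          finally show ?thesis by simp
        qed
        then show "int_box (b (n u)) u \<subseteq> W"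
          using W u int_box_mono[of "b (n u)" "\<lambda>_. int (nat (\<Sum>j\<in>UNIV. b N j))" u] by (auto simp: le_fun_def)
      qed (use mono nonneg fin \<epsilon> p(2) hat_op_nonneg in auto)
    qed
  qed
  moreover have "(\<lambda>N. \<epsilon> * measure M (E N)) \<longlonglongrightarrow> \<epsilon> * measure M (\<Union>N. E N)"
    by (intro tendsto_mult tendsto_const finite_Lim_measure_incseq)
      (auto simp: incseq_def E_def intro: order_trans)
  ultimately have "\<epsilon> * measure M (\<Union>N. E N) \<le> 2 ^ CARD('d) * (\<integral>x. p x \<partial>M)"
    by (intro LIMSEQ_le_const2) auto
  also have "(\<Union>N. E N) = {x \<in> space M. \<exists>n. \<epsilon> * box_sum (b n) (\<lambda>_. 1) x < box_sum (b n) p x}"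
    by (auto simp: E_def)
  finally show ?thesis .
qed

subsection \<open>Mass on the boundary of boxes\<close>

text \<open>If the limit failed on a set \<open>E\<close> of measure \<open>\<delta> > 0\<close>,
  then \<open>face_counting\<close> and \<open>transference\<close> would bound
  \<open>L * \<epsilon> * (\<delta> / 2)\<close> by \<open>2 ^ CARD('d)\<close> for arbitrarily many
  levels \<open>L\<close>. Growth of \<open>\<bar>g n\<bar>\<close> puts the faces of well separated
  scales around one centre into different hyperplanes.\<close>

lemma face_ratio_tendsto_0:
  fixes b :: "nat \<Rightarrow> 'd \<Rightarrow> int" and g :: "nat \<Rightarrow> int"
  assumes mono: "mono b" and nonneg: "\<And>n j. 0 \<le> b n j"
    and g: "filterlim (\<lambda>n. \<bar>g n\<bar>) at_top sequentially"
  shows "AE x in M. (\<lambda>n. (\<Sum>v\<in>face (b n) i (g n) 0. \<omega> v x) / box_sum (b n) (\<lambda>_. 1) x) \<longlonglongrightarrow> 0"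
proof (rule AE_tendsto_0I)
  fix \<epsilon> :: real assume \<epsilon>: "0 < \<epsilon>"
  define bad where "bad n x \<longleftrightarrow> \<epsilon> * box_sum (b n) (\<lambda>_. 1) x < (\<Sum>v\<in>face (b n) i (g n) 0. \<omega> v x)" for n x
  have bad_sets [measurable]: "Measurable.pred M (bad n)" for n
    unfolding bad_def[abs_def] by measurable
  define E where "E = {x \<in> space M. \<forall>N. \<exists>n\<ge>N. bad n x}"
  have E [measurable]: "E \<in> sets M" unfolding E_def by measurable
  define \<delta> where "\<delta> = measure M E"
  have "\<delta> = 0"
  proof (rule ccontr)
    assume "\<delta> \<noteq> 0"
    then have \<delta>: "0 < \<delta>" using zero_less_measure_iff \<delta>_def by metis
    \<comment> \<open>Chosen for the final contradiction
      \<open>2 ^ CARD('d) < L * \<epsilon> * (\<delta> / 2)\<close>; the half is what remains of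
      \<open>E\<close> after passing to \<open>E'\<close>.\<close>
    obtain L :: nat where L: "2 * 2 ^ CARD('d) / (\<epsilon> * \<delta>) < real L" using reals_Archimedean2 by blast
    have "0 < 2 * 2 ^ CARD('d) / (\<epsilon> * \<delta>)" using \<epsilon> \<delta> by simp
    then have "0 < L" using L by (metis less_trans of_nat_0_less_iff)
    \<comment> \<open>\<open>face_counting\<close> asks for more than
      \<open>L * 4 ^ CARD('d)\<close> candidates per level; \<open>J\<close> windows supply
      \<open>Q\<close> candidates at each of \<open>L\<close> levels.\<close>
    define Q where "Q = Suc (L * 4 ^ CARD('d))"
    define J where "J = L * Q"
    have J: "0 < J" using \<open>0 < L\<close> by (simp add: J_def Q_def)
    \<comment> \<open>Every point of \<open>E\<close> is bad at some scale beyond \<open>p\<close>,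
      but without a common bound. The sets of points with no bad scale in \<open>{p..<e}\<close>
      decrease to the empty set, so a long window misses little of \<open>E\<close>.\<close>
    have "\<exists>e\<ge>p. measure M {x \<in> E. \<forall>n\<in>{p..<e}. \<not> bad n x} < \<delta> / (2 * real J)" for p
    proof -
      have "(\<lambda>e. measure M {x \<in> E. \<forall>n\<in>{p..<e}. \<not> bad n x}) \<longlonglongrightarrow>
          measure M (\<Inter>e. {x \<in> E. \<forall>n\<in>{p..<e}. \<not> bad n x})"
      proof (rule finite_Lim_measure_decseq)
        have "{x \<in> E. \<forall>n\<in>{p..<e}. \<not> bad n x} = E \<inter> {x \<in> space M. \<forall>n\<in>{p..<e}. \<not> bad n x}" for e
          by (auto simp: E_def)
        then show "range (\<lambda>e. {x \<in> E. \<forall>n\<in>{p..<e}. \<not> bad n x}) \<subseteq> sets M" by auto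
        show "decseq (\<lambda>e. {x \<in> E. \<forall>n\<in>{p..<e}. \<not> bad n x})"
          by (auto simp: decseq_def)
      qed
      also have "(\<Inter>e. {x \<in> E. \<forall>n\<in>{p..<e}. \<not> bad n x}) = {}"
      proof -
        have False if x: "\<And>e. x \<in> E \<and> (\<forall>n\<in>{p..<e}. \<not> bad n x)" for x
        proof -
          obtain n where "n \<ge> p" "bad n x" using x[of 0] by (auto simp: E_def)
          then show False using x[of "Suc n"] by auto
        qed
        then show ?thesis by blast
      qed
      finally have lim: "(\<lambda>e. measure M {x \<in> E. \<forall>n\<in>{p..<e}. \<not> bad n x}) \<longlonglongrightarrow> 0" by simp
      have "0 < \<delta> / (2 * real J)" using \<delta> J by simp
      with lim have "eventually (\<lambda>e. measure M {x \<in> E. \<forall>n\<in>{p..<e}. \<not> bad n x} < \<delta> / (2 * real J)) sequentially"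
        by (rule order_tendstoD(2))
      with eventually_ge_at_top[of p]
      have "eventually (\<lambda>e. p \<le> e \<and> measure M {x \<in> E. \<forall>n\<in>{p..<e}. \<not> bad n x} < \<delta> / (2 * real J)) sequentially"
        by eventually_elim simp
      from eventually_happens'[OF sequentially_bot this] show ?thesis .
    qed
    then have "\<exists>e. \<forall>p. p \<le> e p \<and> measure M {x \<in> E. \<forall>n\<in>{p..<e p}. \<not> bad n x} < \<delta> / (2 * real J)"
      by (intro choice allI)
    then obtain e where e: "\<And>p. p \<le> e p"
      "\<And>p. measure M {x \<in> E. \<forall>n\<in>{p..<e p}. \<not> bad n x} < \<delta> / (2 * real J)" by blast
    \<comment> \<open>A gap between windows: past \<open>a\<close> all offsets exceed in absolute
      value those before \<open>e\<close>, so bad scales from different windows have different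
      \<open>g\<close>.\<close>
    have "\<exists>a\<ge>e. \<forall>n\<ge>a. \<forall>n'<e. \<bar>g n'\<bar> < \<bar>g n\<bar>" for e
    proof -
      have "eventually (\<lambda>n. \<bar>g n'\<bar> < \<bar>g n\<bar>) sequentially" for n'
        using g[unfolded filterlim_at_top, rule_format, of "\<bar>g n'\<bar> + 1"] by eventually_elim simp
      then have "eventually (\<lambda>n. \<forall>n'\<in>{..<e}. \<bar>g n'\<bar> < \<bar>g n\<bar>) sequentially"
        by (intro eventually_ball_finite) auto
      then obtain a where a: "\<And>n. n \<ge> a \<Longrightarrow> \<forall>n'\<in>{..<e}. \<bar>g n'\<bar> < \<bar>g n\<bar>"
        unfolding eventually_sequentially by auto
      show ?thesis by (intro exI[of _ "max a e"]) (use a in auto)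
    qed
    then have "\<exists>a. \<forall>e. e \<le> a e \<and> (\<forall>n\<ge>a e. \<forall>n'<e. \<bar>g n'\<bar> < \<bar>g n\<bar>)" by (intro choice allI)
    then obtain a where a: "\<And>e. e \<le> a e" "\<And>e n n'. a e \<le> n \<Longrightarrow> n' < e \<Longrightarrow> \<bar>g n'\<bar> < \<bar>g n\<bar>" by blast
    define P where "P = rec_nat 0 (\<lambda>_ p. a (e p))"
    have P_Suc: "P (Suc j) = a (e (P j))" for j by (simp add: P_def)
    have e_P: "e (P j) \<le> P (Suc j)" for j by (simp add: P_Suc a)
    have P_mono: "P j \<le> P j'" if "j \<le> j'" for j j'
      by (rule lift_Suc_mono_le[OF _ that]) (rule order_trans[OF e(1) e_P])
    \<comment> \<open>Each of the \<open>J\<close> windows loses less than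
      \<open>\<delta> / (2 * J)\<close>, so at least half of \<open>E\<close> has a bad scale in all
      of them.\<close>
    define E' where "E' = {x \<in> space M. \<forall>j\<in>{..<J}. \<exists>n\<in>{P j..<e (P j)}. bad n x}"
    have E' [measurable]: "E' \<in> sets M" unfolding E'_def by measurable
    have G: "{x \<in> E. \<forall>n\<in>{P j..<e (P j)}. \<not> bad n x} \<in> sets M" for j
    proof -
      have "{x \<in> E. \<forall>n\<in>{P j..<e (P j)}. \<not> bad n x} = E \<inter> {x \<in> space M. \<forall>n\<in>{P j..<e (P j)}. \<not> bad n x}"
        by (auto simp: E_def)
      then show ?thesis by simp
    qed
    have "\<delta> \<le> measure M (E' \<union> (\<Union>j\<in>{..<J}. {x \<in> E. \<forall>n\<in>{P j..<e (P j)}. \<not> bad n x}))"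
      unfolding \<delta>_def using G by (intro finite_measure_mono sets.Un sets.finite_UN) (auto simp: E'_def E_def)
    also have "\<dots> \<le> measure M E' + measure M (\<Union>j\<in>{..<J}. {x \<in> E. \<forall>n\<in>{P j..<e (P j)}. \<not> bad n x})"
      using G by (intro measure_subadditive sets.finite_UN) auto
    also have "measure M (\<Union>j\<in>{..<J}. {x \<in> E. \<forall>n\<in>{P j..<e (P j)}. \<not> bad n x}) \<le>
        (\<Sum>j<J. measure M {x \<in> E. \<forall>n\<in>{P j..<e (P j)}. \<not> bad n x})"
      using G by (intro finite_measure_subadditive_finite) auto
    also have "\<dots> \<le> (\<Sum>j<J. \<delta> / (2 * real J))" using e(2) by (intro sum_mono less_imp_le)
    also have "\<dots> = \<delta> / 2" using J by simp
    finally have E'_ge: "\<delta> / 2 \<le> measure M E'" by simp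
    have "real L * \<epsilon> * measure M E' \<le> 2 ^ CARD('d) * (\<integral>x. 1 \<partial>M)"
    proof (rule transference[where r = "nat (\<Sum>j\<in>UNIV. b (P J) j)", OF E'])
      show "AE x in M. \<forall>A W. finite A \<longrightarrow> finite W \<longrightarrow> (\<forall>u\<in>A. T u x \<in> E') \<longrightarrow>
        (\<forall>u\<in>A. int_box (\<lambda>_. int (nat (\<Sum>j\<in>UNIV. b (P J) j))) u \<subseteq> W) \<longrightarrow>
        real L * \<epsilon> * (\<Sum>u\<in>A. \<omega> u x) \<le> 2 ^ CARD('d) * (\<Sum>v\<in>W. hat_op M T v (\<lambda>_. 1) x)"
        using AE_regular_point
      proof (eventually_elim, intro allI impI)
        fix x A W assume x: "regular_point x" and fin: "finite A" "finite W"
          and A: "\<forall>u\<in>A. T u x \<in> E'"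
          and W: "\<forall>u\<in>A. int_box (\<lambda>_. int (nat (\<Sum>j\<in>UNIV. b (P J) j))) u \<subseteq> W"
        define n where "n u j = (SOME n. P j \<le> n \<and> n < e (P j) \<and> bad n (T u x))" for u j
        have "P j \<le> n u j \<and> n u j < e (P j) \<and> bad (n u j) (T u x)" if "u \<in> A" "j < J" for u j
          unfolding n_def by (rule someI_ex) (use A that in \<open>fastforce simp: E'_def\<close>)
        then have n: "P j \<le> n u j" "n u j < e (P j)" "bad (n u j) (T u x)" if "u \<in> A" "j < J" for u j
          using that by auto
        \<comment> \<open>The windows form \<open>L\<close> blocks of \<open>Q\<close>. Level
          \<open>k\<close> uses block \<open>L - 1 - k\<close>, so that level 0 has the largest
          scales; \<open>P ((L - k) * Q)\<close> is the first window start after that block.\<close>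
        define s where "s u k q = n u ((L - 1 - k) * Q + q)" for u k q
        have idx: "(L - 1 - k) * Q + q < (L - k) * Q" "(L - k) * Q \<le> J" if "k < L" "q < Q" for k q
        proof -
          have "L - k = Suc (L - 1 - k)" using that by simp
          then show "(L - 1 - k) * Q + q < (L - k) * Q" using that by simp
          show "(L - k) * Q \<le> J" by (simp add: J_def)
        qed
        have s_le: "s u k q \<le> P ((L - k) * Q)" if "u \<in> A" "k < L" "q < Q" for u k q
        proof -
          have "s u k q \<le> P (Suc ((L - 1 - k) * Q + q))"
            unfolding s_def using n(2)[OF that(1)] idx[OF that(2,3)] e_P
            by (meson less_imp_le less_le_trans order_trans)
          also have "\<dots> \<le> P ((L - k) * Q)" using idx[OF that(2,3)] by (intro P_mono) simp
          finally show ?thesis .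
        qed
        have "real L * \<epsilon> * (\<Sum>u\<in>A. \<omega> u x) \<le> 2 ^ CARD('d) * (\<Sum>v\<in>W. \<omega> v x)"
        proof (rule face_counting[where b = b and s = s and Q = Q and g = g and i = i
              and c = "\<lambda>k. P ((L - k) * Q)"])
          fix u k k' q assume u: "u \<in> A" "k < k'" "k' < L" "q < Q"
          have "(L - k') * Q \<le> (L - 1 - k) * Q + q"
            using u by (intro trans_le_add1 mult_right_mono) auto
          then have "P ((L - k') * Q) \<le> P ((L - 1 - k) * Q + q)" by (rule P_mono)
          also have "\<dots> \<le> s u k q" unfolding s_def using u idx[of k q] by (intro n(1)) auto
          finally show "P ((L - k') * Q) \<le> s u k q" .
        next
          fix u k assume u: "u \<in> A" "k < L"
          have ne: "g (s u k q) \<noteq> g (s u k q')" if "q < q'" "q' < Q" for q q'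
          proof -
            have lt: "(L - 1 - k) * Q + q < J" "(L - 1 - k) * Q + q' < J"
              using idx[of k q] idx[of k q'] u that by auto
            have "a (e (P ((L - 1 - k) * Q + q))) \<le> P ((L - 1 - k) * Q + q')"
              unfolding P_Suc[symmetric] using that by (intro P_mono) simp
            also have "\<dots> \<le> s u k q'" unfolding s_def using u lt by (intro n(1)) auto
            finally have "\<bar>g (s u k q)\<bar> < \<bar>g (s u k q')\<bar>"
              by (rule a(2)) (use n(2)[OF u(1) lt(1)] in \<open>simp add: s_def\<close>)
            then show ?thesis by auto
          qed
          show "inj_on (\<lambda>q. g (s u k q)) {..<Q}"
          proof (rule inj_onI, rule ccontr)
            fix q q' assume "q \<in> {..<Q}" "q' \<in> {..<Q}" "g (s u k q) = g (s u k q')" "q \<noteq> q'"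
            then show False using ne[of q q'] ne[of q' q] by (cases "q < q'") auto
          qed
        next
          fix u k q assume u: "u \<in> A" "k < L" "q < Q"
          let ?n = "s u k q"
          have "bad ?n (T u x)" unfolding s_def using u idx[of k q] by (intro n(3)) auto
          then have "\<epsilon> * box_sum (b ?n) (\<lambda>_. 1) (T u x) * \<omega> u x \<le>
              (\<Sum>v\<in>face (b ?n) i (g ?n) 0. \<omega> v (T u x)) * \<omega> u x"
            unfolding bad_def by (intro mult_right_mono) auto
          then show "\<epsilon> * (\<Sum>v\<in>int_box (b ?n) u. \<omega> v x) \<le> (\<Sum>v\<in>face (b ?n) i (g ?n) u. \<omega> v x)"
            using box_sum_shift[OF x, where r = "b ?n" and f = "\<lambda>_. 1" and u = u]
              sum_hat_op_shift[OF x, where B = "face (b ?n) i (g ?n) 0" and f = "\<lambda>_. 1" and u = u]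
            by (simp add: mult.assoc hat_op_1 face_translate[of "b ?n" i "g ?n" u])
          have "b ?n j \<le> int (nat (\<Sum>j\<in>UNIV. b (P J) j))" for j
          proof -
            have "?n \<le> P J" using s_le[OF u] P_mono[OF idx(2)[OF u(2,3)]] by (rule order_trans)
            then have "b ?n j \<le> b (P J) j" using mono by (metis le_funD monoD)
            also have "\<dots> \<le> (\<Sum>j\<in>UNIV. b (P J) j)" using nonneg by (intro member_le_sum) auto
            finally show ?thesis by simp
          qed
          then show "int_box (b ?n) u \<subseteq> W"
            using W u int_box_mono[of "b ?n" "\<lambda>_. int (nat (\<Sum>j\<in>UNIV. b (P J) j))" u]
            by (auto simp: le_fun_def)
        qed (use mono nonneg fin \<epsilon> s_le in \<open>auto simp: Q_def\<close>)
        then show "real L * \<epsilon> * (\<Sum>u\<in>A. \<omega> u x) \<le> 2 ^ CARD('d) * (\<Sum>v\<in>W. hat_op M T v (\<lambda>_. 1) x)"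
          by (simp add: hat_op_1)
      qed
    qed simp
    then have "real L * \<epsilon> * measure M E' \<le> 2 ^ CARD('d)" by (simp add: prob_space)
    moreover have "real L * \<epsilon> * (\<delta> / 2) \<le> real L * \<epsilon> * measure M E'"
      using E'_ge \<epsilon> by (intro mult_left_mono) auto
    moreover have "2 ^ CARD('d) < real L * \<epsilon> * (\<delta> / 2)"
      using L \<epsilon> \<delta> by (simp add: field_simps)
    ultimately show False by linarith
  qed
  then have "AE x in M. x \<notin> E"
    using E by (subst (asm) \<delta>_def) (auto intro!: AE_not_in simp: null_sets_def emeasure_eq_measure)
  with AE_regular_point AE_space
  show "AE x in M. eventually (\<lambda>n. \<bar>(\<Sum>v\<in>face (b n) i (g n) 0. \<omega> v x) / box_sum (b n) (\<lambda>_. 1) x\<bar> \<le> \<epsilon>) sequentially"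
  proof eventually_elim
    case (elim x)
    then obtain N where N: "\<And>n. n \<ge> N \<Longrightarrow> \<not> bad n x" by (auto simp: E_def)
    have "\<bar>(\<Sum>v\<in>face (b n) i (g n) 0. \<omega> v x) / box_sum (b n) (\<lambda>_. 1) x\<bar> \<le> \<epsilon>" if "n \<ge> N" for n
    proof -
      have "0 < box_sum (b n) (\<lambda>_. 1) x" using box_sum_1_ge_1[OF elim(1), of "b n"] nonneg by simp
      moreover have "0 \<le> (\<Sum>v\<in>face (b n) i (g n) 0. \<omega> v x)" by (simp add: sum_nonneg)
      ultimately show ?thesis using N[OF that] by (simp add: bad_def field_simps)
    qed
    then show ?case unfolding eventually_sequentially by blast
  qed
qed

text \<open>The shell consists of a number of slices that does not depend on \<open>n\<close>, each
  covered by \<open>face_ratio_tendsto_0\<close>. The denominators belong to the enlarged boxes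
  because these contain the slices.\<close>

lemma boundary_ratio_tendsto_0:
  fixes b :: "nat \<Rightarrow> 'd \<Rightarrow> int" and c :: int
  assumes mono: "mono b" and nonneg: "\<And>n j. 0 \<le> b n j" and c: "0 \<le> c"
    and lim: "\<And>j. filterlim (\<lambda>n. b n j) at_top sequentially"
  shows "AE x in M. (\<lambda>n. (\<Sum>v\<in>{v \<in> int_box (\<lambda>j. b n j + c) 0. \<exists>i. b n i - c \<le> \<bar>v $ i\<bar>}. \<omega> v x) /
    box_sum (\<lambda>j. b n j + c) (\<lambda>_. 1) x) \<longlonglongrightarrow> 0"
proof -
  let ?b = "\<lambda>n j. b n j + c"
  let ?m = "\<lambda>x n. box_sum (?b n) (\<lambda>_. 1) x"
  have mono': "mono ?b" using mono by (auto simp: mono_def le_fun_def)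
  have lim': "filterlim (\<lambda>n. \<bar>b n i + t\<bar>) at_top sequentially" "filterlim (\<lambda>n. \<bar>- (b n i + t)\<bar>) at_top sequentially" for i t
  proof -
    show "filterlim (\<lambda>n. \<bar>b n i + t\<bar>) at_top sequentially"
      unfolding filterlim_at_top
    proof
      fix Z :: int
      show "eventually (\<lambda>n. Z \<le> \<bar>b n i + t\<bar>) sequentially"
        using lim[of i, unfolded filterlim_at_top, rule_format, of "Z - t"] by eventually_elim linarith
    qed
    then show "filterlim (\<lambda>n. \<bar>- (b n i + t)\<bar>) at_top sequentially" by (simp only: abs_minus_cancel)
  qed
  have "AE x in M. \<forall>i t. (\<lambda>n. (\<Sum>v\<in>face (?b n) i (b n i + t) 0. \<omega> v x) / ?m x n) \<longlonglongrightarrow> 0"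
    unfolding AE_all_countable using nonneg c by (intro allI face_ratio_tendsto_0 mono' lim') simp
  moreover have "AE x in M. \<forall>i t. (\<lambda>n. (\<Sum>v\<in>face (?b n) i (- (b n i + t)) 0. \<omega> v x) / ?m x n) \<longlonglongrightarrow> 0"
    unfolding AE_all_countable using nonneg c by (intro allI face_ratio_tendsto_0 mono' lim') simp
  ultimately show ?thesis using AE_regular_point
  proof eventually_elim
    case (elim x)
    let ?D = "\<lambda>n. {v \<in> int_box (?b n) 0. \<exists>i. b n i - c \<le> \<bar>v $ i\<bar>}"
    let ?R = "\<lambda>n. \<Sum>(i, t)\<in>UNIV \<times> {- c..c}. (\<Sum>v\<in>face (?b n) i (b n i + t) 0. \<omega> v x) / ?m x n +
      (\<Sum>v\<in>face (?b n) i (- (b n i + t)) 0. \<omega> v x) / ?m x n"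
    have "?R \<longlonglongrightarrow> (\<Sum>(i, t)\<in>(UNIV :: 'd set) \<times> {- c..c}. 0 + 0)"
      using elim(1,2) by (intro tendsto_sum) (auto intro!: tendsto_add_zero)
    then have R: "?R \<longlonglongrightarrow> 0" by simp
    show ?case
    proof (rule tendsto_sandwich[OF _ _ tendsto_const R])
      have pos: "0 < ?m x n" for n
        using box_sum_1_ge_1[OF elim(3), of "?b n"] nonneg c by (simp add: add_nonneg_nonneg)
      show "eventually (\<lambda>n. 0 \<le> (\<Sum>v\<in>?D n. \<omega> v x) / ?m x n) sequentially"
        using pos by (intro always_eventually allI divide_nonneg_pos sum_nonneg) auto
      have "(\<Sum>v\<in>?D n. \<omega> v x) / ?m x n \<le> ?R n" for n
      proof -
        have "(\<Sum>v\<in>?D n. \<omega> v x) \<le> (\<Sum>it\<in>UNIV \<times> {- c..c}. \<Sum>v\<in>(case it of (i, t) \<Rightarrow>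
            face (?b n) i (b n i + t) 0 \<union> face (?b n) i (- (b n i + t)) 0). \<omega> v x)"
          by (rule sum_UNION_le[OF _ _ _ int_box_boundary_subset]) (auto simp: finite_face)
        also have "\<dots> \<le> (\<Sum>(i, t)\<in>UNIV \<times> {- c..c}. (\<Sum>v\<in>face (?b n) i (b n i + t) 0. \<omega> v x) +
            (\<Sum>v\<in>face (?b n) i (- (b n i + t)) 0. \<omega> v x))"
        proof (rule sum_mono, clarify)
          fix i t
          show "(\<Sum>v\<in>face (?b n) i (b n i + t) 0 \<union> face (?b n) i (- (b n i + t)) 0. \<omega> v x) \<le>
              (\<Sum>v\<in>face (?b n) i (b n i + t) 0. \<omega> v x) + (\<Sum>v\<in>face (?b n) i (- (b n i + t)) 0. \<omega> v x)"
            by (subst sum_Un) (auto simp: finite_face intro!: sum_nonneg)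
        qed
        finally have "(\<Sum>v\<in>?D n. \<omega> v x) / ?m x n \<le> (\<Sum>(i, t)\<in>UNIV \<times> {- c..c}. (\<Sum>v\<in>face (?b n) i (b n i + t) 0. \<omega> v x) +
            (\<Sum>v\<in>face (?b n) i (- (b n i + t)) 0. \<omega> v x)) / ?m x n"
          using pos[of n] by (intro divide_right_mono) auto
        also have "\<dots> = ?R n"
          by (simp add: sum_divide_distrib case_prod_beta add_divide_distrib)
        finally show ?thesis .
      qed
      then show "eventually (\<lambda>n. (\<Sum>v\<in>?D n. \<omega> v x) / ?m x n \<le> ?R n) sequentially" by simp
    qed
  qed
qed

subsection \<open>The ratio ergodic theorem for boxes\<close>

definition ratio_null :: "(nat \<Rightarrow> 'd \<Rightarrow> int) \<Rightarrow> ('x \<Rightarrow> real) \<Rightarrow> bool" where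
  "ratio_null b f \<longleftrightarrow> (AE x in M. (\<lambda>n. box_sum (b n) f x / box_sum (b n) (\<lambda>_. 1) x) \<longlonglongrightarrow> 0)"

lemma ratio_null_0: "ratio_null b (\<lambda>_. 0)"
  by (simp add: ratio_null_def box_sum_def hat_op_def)

lemma ratio_null_add: "ratio_null b f \<Longrightarrow> ratio_null b g \<Longrightarrow> ratio_null b (\<lambda>x. f x + g x)"
  unfolding ratio_null_def
  by (erule (1) AE_mp[OF _ AE_mp]) (auto simp: box_sum_add add_divide_distrib intro!: tendsto_add_zero)

lemma ratio_null_cmult: "ratio_null b f \<Longrightarrow> ratio_null b (\<lambda>x. c * f x)"
  unfolding ratio_null_def
  by (erule AE_mp) (auto simp: box_sum_cmult intro!: tendsto_mult_right_zero simp flip: times_divide_eq_right)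

text \<open>The sum telescopes to the sum of \<open>hat_op M T v \<psi> x\<close> over the box
  shifted by \<open>u\<close> minus that over the box itself. Only the symmetric difference
  survives, and it lies in the shell \<open>D n\<close>, whose half-width \<open>c\<close> bounds
  all coordinates of \<open>u\<close>.\<close>

lemma ratio_null_coboundary:
  fixes b :: "nat \<Rightarrow> 'd \<Rightarrow> int"
  assumes mono: "mono b" and nonneg: "\<And>n j. 0 \<le> b n j"
    and lim: "\<And>j. filterlim (\<lambda>n. b n j) at_top sequentially"
    and \<psi>: "\<And>x. \<bar>\<psi> x\<bar> \<le> C"
  shows "ratio_null b (\<lambda>x. hat_op M T u \<psi> x - \<psi> x)"
proof -
  define c where "c = (\<Sum>j\<in>UNIV. \<bar>u $ j\<bar>)"
  have c: "0 \<le> c" "\<bar>u $ j\<bar> \<le> c" for j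
    unfolding c_def by (auto intro: sum_nonneg member_le_sum)
  have C: "0 \<le> C" using \<psi>[of undefined] by simp
  define B where "B n = int_box (b n) (0 :: int ^ 'd)" for n
  define B' where "B' n = int_box (\<lambda>j. b n j + c) (0 :: int ^ 'd)" for n
  define D where "D n = {v \<in> B' n. \<exists>i. b n i - c \<le> \<bar>v $ i\<bar>}" for n
  have fin: "finite (B n)" "finite (B' n)" "finite (D n)" "finite (int_box (b n) u)" for n
    by (auto simp: B_def B'_def D_def finite_int_box)
  have sub: "B' n - B n \<subseteq> D n" "B n - int_box (b n) u \<subseteq> D n" "int_box (b n) u - B n \<subseteq> D n" for n
  proof -
    show "B' n - B n \<subseteq> D n"
    proof
      fix v assume v: "v \<in> B' n - B n"
      then obtain i where "\<not> \<bar>v $ i\<bar> \<le> b n i" by (auto simp: B_def mem_int_box)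
      then have "b n i - c \<le> \<bar>v $ i\<bar>" using c(1) by linarith
      then show "v \<in> D n" using v by (auto simp: D_def)
    qed
    show "B n - int_box (b n) u \<subseteq> D n"
    proof
      fix v assume v: "v \<in> B n - int_box (b n) u"
      then obtain i where i: "\<not> \<bar>v $ i - u $ i\<bar> \<le> b n i" by (auto simp: mem_int_box)
      have "b n i - c \<le> \<bar>v $ i\<bar>" using c(2)[of i] i by linarith
      moreover have "v \<in> B' n"
        using v int_box_mono[of "b n" "\<lambda>j. b n j + c" 0] c(1) by (auto simp: B_def B'_def le_fun_def)
      ultimately show "v \<in> D n" by (auto simp: D_def)
    qed
    show "int_box (b n) u - B n \<subseteq> D n"
    proof
      fix v assume v: "v \<in> int_box (b n) u - B n"
      then obtain i where "\<not> \<bar>v $ i\<bar> \<le> b n i" by (auto simp: B_def mem_int_box)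
      then have "b n i - c \<le> \<bar>v $ i\<bar>" using c(1) by linarith
      moreover have "\<bar>v $ j\<bar> \<le> b n j + c" for j
      proof -
        have "\<bar>v $ j - u $ j\<bar> \<le> b n j" using v by (simp add: mem_int_box)
        then show ?thesis using c(2)[of j] by linarith
      qed
      ultimately show "v \<in> D n" by (auto simp: D_def B'_def mem_int_box)
    qed
  qed
  have "AE x in M. (\<lambda>n. (\<Sum>v\<in>D n. \<omega> v x) / (\<Sum>v\<in>B' n. \<omega> v x)) \<longlonglongrightarrow> 0"
    using boundary_ratio_tendsto_0[OF mono nonneg c(1) lim]
    by (simp add: D_def B'_def box_sum_def hat_op_1)
  then show ?thesis
    unfolding ratio_null_def using AE_regular_point
  proof eventually_elim
    case (elim x)
    let ?h = "\<lambda>v. hat_op M T v \<psi> x"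
    let ?\<rho> = "\<lambda>n. (\<Sum>v\<in>D n. \<omega> v x) / (\<Sum>v\<in>B' n. \<omega> v x)"
    have h: "\<bar>?h v\<bar> \<le> C * \<omega> v x" for v
      using \<psi> by (auto simp: hat_op_def abs_mult intro!: mult_right_mono)
    have part: "\<bar>sum ?h S\<bar> \<le> C * (\<Sum>v\<in>D n. \<omega> v x)" if "S \<subseteq> D n" for S n
    proof -
      have "\<bar>sum ?h S\<bar> \<le> (\<Sum>v\<in>S. C * \<omega> v x)"
        by (rule order_trans[OF sum_abs]) (rule sum_mono[OF h])
      also have "\<dots> \<le> (\<Sum>v\<in>D n. C * \<omega> v x)" using that fin C by (intro sum_mono2) auto
      finally show ?thesis by (simp add: sum_distrib_left)
    qed
    have num: "\<bar>box_sum (b n) (\<lambda>x. hat_op M T u \<psi> x - \<psi> x) x\<bar> \<le> 2 * C * (\<Sum>v\<in>D n. \<omega> v x)" for n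
    proof -
      have "hat_op M T v (\<lambda>x. hat_op M T u \<psi> x - \<psi> x) x = ?h (v + u) - ?h v" for v
      proof -
        have "hat_op M T v (\<lambda>x. hat_op M T u \<psi> x - \<psi> x) x = hat_op M T u \<psi> (T v x) * \<omega> v x - ?h v"
          by (simp add: hat_op_def algebra_simps)
        then show ?thesis by (simp add: hat_op_shift[OF elim(2)] add.commute)
      qed
      then have "box_sum (b n) (\<lambda>x. hat_op M T u \<psi> x - \<psi> x) x = (\<Sum>v\<in>B n. ?h (v + u)) - sum ?h (B n)"
        by (simp add: box_sum_def B_def sum_subtractf)
      also have "(\<Sum>v\<in>B n. ?h (v + u)) = sum ?h (int_box (b n) u)"
        unfolding int_box_translate[of "b n" u] B_def by (subst sum.reindex) auto
      also have "sum ?h (int_box (b n) u) - sum ?h (B n) =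
          sum ?h (int_box (b n) u - B n) - sum ?h (B n - int_box (b n) u)"
        using sum.Int_Diff[OF fin(4)[of n], of ?h "B n"] sum.Int_Diff[OF fin(1)[of n], of ?h "int_box (b n) u"]
        by (simp add: Int_commute)
      finally show ?thesis using part[OF sub(3)[of n]] part[OF sub(2)[of n]] by linarith
    qed
    \<comment> \<open>The boundary estimate divides by the mass of the enlarged box
      \<open>B' n\<close>. Once the shell carries less than half of that, the original box carries
      at least half, so the change of denominator costs a factor 2 and \<open>2 * C\<close> becomes
      \<open>4 * C\<close>.\<close>
    have den: "(\<Sum>v\<in>B' n. \<omega> v x) \<le> box_sum (b n) (\<lambda>_. 1) x + (\<Sum>v\<in>D n. \<omega> v x)" for n
    proof -
      have "(\<Sum>v\<in>B' n. \<omega> v x) \<le> (\<Sum>v\<in>B n \<union> D n. \<omega> v x)"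
        using fin sub(1)[of n] by (intro sum_mono2) auto
      also have "\<dots> \<le> (\<Sum>v\<in>B n. \<omega> v x) + (\<Sum>v\<in>D n. \<omega> v x)"
        using fin by (subst sum_Un) (auto intro!: sum_nonneg)
      finally show ?thesis by (simp add: box_sum_def B_def hat_op_1)
    qed
    have pos: "0 < box_sum (b n) (\<lambda>_. 1) x" for n
      using box_sum_1_ge_1[OF elim(2), of "b n"] nonneg by simp
    have pos': "0 < (\<Sum>v\<in>B' n. \<omega> v x)" for n
      using box_sum_1_ge_1[OF elim(2), of "\<lambda>j. b n j + c"] nonneg c(1)
      by (simp add: box_sum_def hat_op_1 B'_def add_nonneg_nonneg)
    have "eventually (\<lambda>n. ?\<rho> n < 1 / 2) sequentially"
      using elim(1) by (rule order_tendstoD) simp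
    then have "eventually (\<lambda>n. norm (box_sum (b n) (\<lambda>x. hat_op M T u \<psi> x - \<psi> x) x / box_sum (b n) (\<lambda>_. 1) x) \<le>
        4 * C * ?\<rho> n) sequentially"
    proof eventually_elim
      case (elim n)
      let ?D = "\<Sum>v\<in>D n. \<omega> v x" and ?B' = "\<Sum>v\<in>B' n. \<omega> v x" and ?B = "box_sum (b n) (\<lambda>_. 1) x"
      have D: "0 \<le> ?D" by (simp add: sum_nonneg)
      have "?D < ?B' / 2" using elim pos'[of n] by (simp add: field_simps)
      then have "?B' / 2 \<le> ?B" using den[of n] by linarith
      have "\<bar>box_sum (b n) (\<lambda>x. hat_op M T u \<psi> x - \<psi> x) x\<bar> / ?B \<le> 2 * C * ?D / ?B"
        using num[of n] pos[of n] by (intro divide_right_mono) auto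
      also have "\<dots> \<le> 2 * C * ?D / (?B' / 2)"
        using \<open>?B' / 2 \<le> ?B\<close> pos'[of n] D C by (intro divide_left_mono mult_pos_pos pos) auto
      also have "\<dots> = 4 * C * (?D / ?B')" by simp
      finally show ?case using pos[of n] by (simp add: abs_divide)
    qed
    moreover have "(\<lambda>n. 4 * C * ?\<rho> n) \<longlonglongrightarrow> 0" using elim(1) by (rule tendsto_mult_right_zero)
    ultimately show ?case by (rule Lim_null_comparison)
  qed
qed

text \<open>Banach principle: where the ratios of \<open>f\<close> exceed \<open>\<epsilon>\<close>
  infinitely often while those of \<open>k\<close> are eventually below
  \<open>\<epsilon> / 2\<close>, the maximal function of \<open>\<bar>f x - k x\<bar>\<close>
  exceeds \<open>\<epsilon> / 2\<close>. The weak type bound makes such points rare.\<close>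

lemma ratio_null_closed:
  fixes b :: "nat \<Rightarrow> 'd \<Rightarrow> int"
  assumes mono: "mono b" and nonneg: "\<And>n j. 0 \<le> b n j"
    and f: "integrable M f"
    and approx: "\<And>\<eta>. 0 < \<eta> \<Longrightarrow> \<exists>k. integrable M k \<and> ratio_null b k \<and> (\<integral>x. \<bar>f x - k x\<bar> \<partial>M) < \<eta>"
  shows "ratio_null b f"
  unfolding ratio_null_def
proof (rule AE_tendsto_0I)
  fix \<epsilon> :: real assume \<epsilon>: "0 < \<epsilon>"
  let ?R = "\<lambda>g n x. box_sum (b n) g x / box_sum (b n) (\<lambda>_. 1) x"
  have [measurable]: "f \<in> borel_measurable M" using f by simp
  define Z where "Z = {x \<in> space M. \<forall>N. \<exists>n\<ge>N. \<epsilon> < \<bar>?R f n x\<bar>}"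
  have Z [measurable]: "Z \<in> sets M" unfolding Z_def by measurable
  have "\<epsilon> / 2 * measure M Z \<le> 0 + \<eta>" if \<eta>: "0 < \<eta>" for \<eta>
  proof -
    \<comment> \<open>The divisor absorbs the constant of \<open>maximal_inequality\<close>.\<close>
    have "0 < \<eta> / 2 ^ CARD('d)" using \<eta> by simp
    from approx[OF this] obtain k where k: "integrable M k" "ratio_null b k"
      "(\<integral>x. \<bar>f x - k x\<bar> \<partial>M) < \<eta> / 2 ^ CARD('d)" by blast
    have [measurable]: "k \<in> borel_measurable M" using k by simp
    let ?p = "\<lambda>x. \<bar>f x - k x\<bar>"
    let ?E = "{x \<in> space M. \<exists>n. \<epsilon> / 2 * box_sum (b n) (\<lambda>_. 1) x < box_sum (b n) ?p x}"
    have "AE x in M. x \<in> Z \<longrightarrow> x \<in> ?E"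
      using k(2)[unfolded ratio_null_def] AE_regular_point
    proof eventually_elim
      case (elim x)
      show ?case
      proof
        assume "x \<in> Z"
        have "eventually (\<lambda>n. \<bar>?R k n x\<bar> < \<epsilon> / 2) sequentially"
          using tendsto_rabs_zero[OF elim(1)] by (rule order_tendstoD) (use \<epsilon> in simp)
        then obtain N where N: "\<And>n. n \<ge> N \<Longrightarrow> \<bar>?R k n x\<bar> < \<epsilon> / 2" unfolding eventually_sequentially by blast
        obtain n where n: "n \<ge> N" "\<epsilon> < \<bar>?R f n x\<bar>" using \<open>x \<in> Z\<close> by (auto simp: Z_def)
        let ?B = "box_sum (b n) (\<lambda>_. 1) x"
        have pos: "0 < ?B" using box_sum_1_ge_1[OF elim(2), of "b n"] nonneg by simp
        have "box_sum (b n) (\<lambda>x. f x - k x) x = box_sum (b n) f x - box_sum (b n) k x"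
          by (simp add: box_sum_def hat_op_def left_diff_distrib sum_subtractf)
        then have "?R (\<lambda>x. f x - k x) n x = ?R f n x - ?R k n x" by (simp add: diff_divide_distrib)
        then have "\<epsilon> / 2 < \<bar>?R (\<lambda>x. f x - k x) n x\<bar>" using N[OF n(1)] n(2) by linarith
        then have "\<epsilon> / 2 * ?B < \<bar>box_sum (b n) (\<lambda>x. f x - k x) x\<bar>" using pos by (simp add: field_simps)
        also have "\<dots> \<le> box_sum (b n) ?p x" by (rule abs_box_sum_le)
        finally show "x \<in> ?E" using elim(2) by (auto simp: regular_point_def)
      qed
    qed
    then have "measure M Z \<le> measure M ?E" by (intro finite_measure_mono_AE) auto
    then have "\<epsilon> / 2 * measure M Z \<le> \<epsilon> / 2 * measure M ?E" using \<epsilon> by (intro mult_left_mono) auto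
    also have "\<dots> \<le> 2 ^ CARD('d) * (\<integral>x. ?p x \<partial>M)"
      using f k(1) \<epsilon> by (intro maximal_inequality mono nonneg) auto
    also have "\<dots> \<le> \<eta>" using k(3) by (simp add: field_simps)
    finally show ?thesis by simp
  qed
  then have "\<epsilon> / 2 * measure M Z \<le> 0" by (rule field_le_epsilon)
  then have "measure M Z = 0" using \<epsilon> by (simp add: mult_le_0_iff measure_le_0_iff)
  then have "AE x in M. x \<notin> Z"
    by (auto intro!: AE_not_in simp: null_sets_def emeasure_eq_measure)
  with AE_space show "AE x in M. eventually (\<lambda>n. \<bar>?R f n x\<bar> \<le> \<epsilon>) sequentially"
  proof eventually_elim
    case (elim x)
    then show ?case by (auto simp: Z_def eventually_sequentially not_less)
  qed
qed

section \<open>Ergodicity and identification of the limit\<close>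

lemma invariant_AE_const:
  fixes r :: "'x \<Rightarrow> real"
  assumes erg: "ergodic_action M T" and r: "integrable M r"
    and inv: "\<And>u. AE x in M. r (T u x) = r x"
  shows "AE x in M. r x = (\<integral>x. r x \<partial>M)"
proof -
  have [measurable]: "r \<in> borel_measurable M" using r by simp
  define c where "c = (\<integral>x. r x \<partial>M)"
  \<comment> \<open>\<open>ergodic_action\<close> speaks of strictly invariant sets, while
    \<open>r\<close> is invariant only almost everywhere; quantifying over the whole orbit makes
    \<open>A\<close> strictly invariant.\<close>
  define A where "A = {x \<in> space M. \<forall>u. c < r (T u x)}"
  have A [measurable]: "A \<in> sets M" unfolding A_def by measurable
  have "T v -` A \<inter> space M = A" for v
  proof -
    have "(\<forall>u. c < r (T u (T v x))) \<longleftrightarrow> (\<forall>u. c < r (T u x))" if x: "x \<in> space M" for x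
    proof
      assume *: "\<forall>u. c < r (T u (T v x))"
      show "\<forall>u. c < r (T u x)"
      proof
        fix u
        show "c < r (T u x)" using *[rule_format, of "u - v"] by (simp flip: T_add[OF x])
      qed
    qed (simp flip: T_add[OF x])
    then show ?thesis by (auto simp: A_def T_in_space)
  qed
  then have cases: "emeasure M A = 0 \<or> emeasure M (space M - A) = 0"
    using erg A by (auto simp: ergodic_action_def)
  have inv': "AE x in M. \<forall>u. r (T u x) = r x" unfolding AE_all_countable using inv by blast
  have "AE x in M. r x \<le> c"
    using cases
  proof
    assume "emeasure M A = 0"
    then have "AE x in M. x \<notin> A" using A by (intro AE_not_in) auto
    with inv' AE_space show ?thesis by eventually_elim (auto simp: A_def)
  next
    assume "emeasure M (space M - A) = 0"
    then have "AE x in M. x \<notin> space M - A" by (intro AE_not_in) auto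
    with inv' AE_space have gt: "AE x in M. c < r x" by eventually_elim (auto simp: A_def)
    \<comment> \<open>A function that exceeds its mean almost everywhere must equal it almost
      everywhere, so \<open>r x \<le> c\<close> holds in this case too. The same argument applied to
      \<open>c - r x\<close> then finishes.\<close>
    have "(\<integral>x. r x - c \<partial>M) = 0" using r by (simp add: c_def prob_space)
    then have "AE x in M. r x - c = 0"
      using r gt by (subst (asm) integral_nonneg_eq_0_iff_AE) auto
    then show ?thesis by eventually_elim simp
  qed
  moreover have "(\<integral>x. c - r x \<partial>M) = 0" using r by (simp add: c_def prob_space)
  ultimately have "AE x in M. c - r x = 0"
    using r by (subst (asm) integral_nonneg_eq_0_iff_AE) auto
  then show ?thesis by eventually_elim (simp add: c_def)
qed

text \<open>The test functions \<open>\<psi>\<close> are cut off where \<open>\<omega>\<close> is large, so that the coboundary is bounded.\<close>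

lemma orthogonal_to_coboundaries_imp_invariant:
  fixes r :: "'x \<Rightarrow> real"
  assumes r: "integrable M r"
    and orth: "\<And>\<psi> C C'. \<psi> \<in> borel_measurable M \<Longrightarrow> (\<And>x. \<bar>\<psi> x\<bar> \<le> C) \<Longrightarrow>
      (\<And>x. x \<in> space M \<Longrightarrow> \<bar>hat_op M T u \<psi> x\<bar> \<le> C') \<Longrightarrow>
      (\<integral>x. r x * (hat_op M T u \<psi> x - \<psi> x) \<partial>M) = 0"
  shows "AE x in M. r (T (- u) x) = r x"
proof -
  have [measurable]: "r \<in> borel_measurable M" using r by simp
  have "AE x in M. \<omega> u (T (- u) x) \<le> real n \<longrightarrow> r (T (- u) x) = r x" for n
  proof -
    \<comment> \<open>The sign turns orthogonality into the vanishing of the L1 norm of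
      \<open>r (T (- u) x) - r x\<close> on the region kept. Since \<open>hat_op\<close> evaluates
      \<open>\<psi>\<close> at \<open>T u x\<close>, the cut-off there reads
      \<open>\<omega> u x \<le> n\<close>.\<close>
    define \<psi> where "\<psi> x = (if \<omega> u (T (- u) x) \<le> real n then sgn (r (T (- u) x) - r x) else 0)" for x
    have [measurable]: "\<psi> \<in> borel_measurable M" unfolding \<psi>_def[abs_def] by measurable
    have \<psi>_le: "\<bar>\<psi> x\<bar> \<le> 1" for x by (simp add: \<psi>_def sgn_if)
    have hat_le: "\<bar>hat_op M T u \<psi> x\<bar> \<le> real n" if "x \<in> space M" for x
      using that by (auto simp: hat_op_def \<psi>_def T_uminus sgn_if abs_mult)
    have "integrable M (\<lambda>x. r x * hat_op M T u \<psi> x)"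
    proof (rule Bochner_Integration.integrable_bound)
      show "integrable M (\<lambda>x. real n * r x)" using r by simp
      show "AE x in M. norm (r x * hat_op M T u \<psi> x) \<le> norm (real n * r x)"
        using mult_left_mono[OF hat_le, of _ "\<bar>r _\<bar>"] by (intro AE_I2) (simp add: abs_mult mult.commute)
    qed simp
    \<comment> \<open>As \<open>x\<close> is \<open>T (- u) (T u x)\<close>, the factor
      \<open>r x\<close> can be moved inside \<open>hat_op\<close>, whose integral is known; this
      computes the adjoint of \<open>hat_op\<close>.\<close>
    moreover have hat_eq: "r x * hat_op M T u \<psi> x = hat_op M T u (\<lambda>y. r (T (- u) y) * \<psi> y) x"
      if "x \<in> space M" for x using that by (simp add: hat_op_def T_uminus)
    ultimately have 1: "integrable M (\<lambda>x. r x * hat_op M T u \<psi> x)"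
      "integrable M (\<lambda>y. r (T (- u) y) * \<psi> y)"
      by (simp_all cong: Bochner_Integration.integrable_cong add: integrable_hat_op_iff)
    have 2: "integrable M (\<lambda>x. r x * \<psi> x)"
      using r \<psi>_le by (intro Bochner_Integration.integrable_bound[OF r]) (auto simp: abs_mult intro!: mult_right_le_one_le)
    have "0 = (\<integral>x. r x * hat_op M T u \<psi> x - r x * \<psi> x \<partial>M)"
      using orth[of \<psi> 1 "real n"] \<psi>_le hat_le by (simp add: right_diff_distrib)
    also have "\<dots> = (\<integral>x. r x * hat_op M T u \<psi> x \<partial>M) - (\<integral>x. r x * \<psi> x \<partial>M)" using 1 2 by simp
    also have "(\<integral>x. r x * hat_op M T u \<psi> x \<partial>M) = (\<integral>x. hat_op M T u (\<lambda>y. r (T (- u) y) * \<psi> y) x \<partial>M)"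
      by (intro Bochner_Integration.integral_cong hat_eq) auto
    also have "\<dots> = (\<integral>y. r (T (- u) y) * \<psi> y \<partial>M)" by (rule integral_hat_op) measurable
    also have "\<dots> - (\<integral>x. r x * \<psi> x \<partial>M) = (\<integral>y. (r (T (- u) y) - r y) * \<psi> y \<partial>M)"
      using 1 2 by (simp add: left_diff_distrib)
    finally have "(\<integral>y. (r (T (- u) y) - r y) * \<psi> y \<partial>M) = 0" by simp
    moreover have "integrable M (\<lambda>y. (r (T (- u) y) - r y) * \<psi> y)"
      using 1 2 by (simp add: left_diff_distrib)
    moreover have "0 \<le> (r (T (- u) y) - r y) * \<psi> y" for y
      by (auto simp: \<psi>_def sgn_if)
    ultimately have "AE y in M. (r (T (- u) y) - r y) * \<psi> y = 0"
      by (subst (asm) integral_nonneg_eq_0_iff_AE) auto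
    then show ?thesis by eventually_elim (auto simp: \<psi>_def sgn_if split: if_splits)
  qed
  then have "AE x in M. \<forall>n. \<omega> u (T (- u) x) \<le> real n \<longrightarrow> r (T (- u) x) = r x"
    unfolding AE_all_countable by blast
  then show ?thesis
  proof eventually_elim
    case (elim x)
    \<comment> \<open>\<open>\<omega>\<close> is real-valued, so the cut-offs exhaust the
      space.\<close>
    obtain n where "\<omega> u (T (- u) x) \<le> real n" using real_arch_simple by blast
    with elim show ?case by blast
  qed
qed

text \<open>The residual \<open>r x = \<phi> x - l x\<close> is orthogonal to bounded coboundaries,
  hence invariant and constant. As \<open>l\<close> has mean 0, the constant is the mean of
  \<open>\<phi>\<close>, so the functions \<open>k n\<close> approximate \<open>\<phi>\<close> minus
  its mean in L1.\<close>

lemma ratio_null_bounded: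
  fixes b :: "nat \<Rightarrow> 'd \<Rightarrow> int"
  assumes erg: "ergodic_action M T"
    and mono: "mono b" and nonneg: "\<And>n j. 0 \<le> b n j"
    and lim: "\<And>j. filterlim (\<lambda>n. b n j) at_top sequentially"
    and [measurable]: "\<phi> \<in> borel_measurable M" and \<phi>: "\<And>x. \<bar>\<phi> x\<bar> \<le> C"
  shows "ratio_null b (\<lambda>x. \<phi> x - (\<integral>y. \<phi> y \<partial>M))"
proof -
  \<comment> \<open>Taking all mean-zero square-integrable functions with null ratios, instead of
    combinations of coboundaries, gives a linear space at once, and each approximant comes with the
    convergence that \<open>ratio_null_closed\<close> asks for.\<close>
  define K where "K = {k. k \<in> borel_measurable M \<and> integrable M (\<lambda>x. (k x)\<^sup>2) \<and>
    (\<integral>x. k x \<partial>M) = 0 \<and> ratio_null b k}"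
  have int: "integrable M \<phi>" using \<phi> by (intro integrable_const_bound[where B = C]) auto
  have sq_bounded: "integrable M (\<lambda>x. (f x)\<^sup>2)"
    if [measurable]: "f \<in> borel_measurable M" and f: "\<And>x. x \<in> space M \<Longrightarrow> \<bar>f x\<bar> \<le> B" for f and B :: real
  proof (rule integrable_const_bound[where B = "B\<^sup>2"])
    have "(f x)\<^sup>2 \<le> B\<^sup>2" if "x \<in> space M" for x using f[OF that] by (rule abs_le_square_iff[THEN iffD1, OF order_trans]) simp
    then show "AE x in M. norm ((f x)\<^sup>2) \<le> B\<^sup>2" by (intro AE_I2) simp
  qed simp
  have intK: "integrable M k" if "k \<in> K" for k
    using that by (auto simp: K_def intro: square_integrable_imp_integrable)
  obtain k l where k: "\<And>n :: nat. k n \<in> K" and l: "integrable M l" "(\<lambda>n. \<integral>x. \<bar>k n x - l x\<bar> \<partial>M) \<longlonglongrightarrow> 0"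
    and orth: "\<And>h C. h \<in> K \<Longrightarrow> AE x in M. \<bar>h x\<bar> \<le> C \<Longrightarrow> (\<integral>x. (\<phi> x - l x) * h x \<partial>M) = 0"
  proof (rule L2_projection[of K \<phi>])
    show "(\<lambda>_. 0) \<in> K" by (simp add: K_def ratio_null_0)
    show "(\<lambda>x. f x + g x) \<in> K" if "f \<in> K" "g \<in> K" for f g
      using that intK[OF that(1)] intK[OF that(2)]
      by (auto simp: K_def intro!: integrable_square_add ratio_null_add)
    show "(\<lambda>x. c * f x) \<in> K" if "f \<in> K" for c f
      using that by (auto simp: K_def power_mult_distrib intro!: ratio_null_cmult)
    show "integrable M (\<lambda>x. (\<phi> x)\<^sup>2)" using \<phi> by (intro sq_bounded) auto
  qed (use that in \<open>auto simp: K_def\<close>)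
  define r where "r x = \<phi> x - l x" for x
  have r: "integrable M r" unfolding r_def[abs_def] using int l(1) by simp
  have "AE x in M. r (T (- u) x) = r x" for u
  proof (rule orthogonal_to_coboundaries_imp_invariant[OF r])
    fix \<psi> C C' assume \<psi> [measurable]: "\<psi> \<in> borel_measurable M" and C: "\<And>x. \<bar>\<psi> x\<bar> \<le> C"
      and C': "\<And>x. x \<in> space M \<Longrightarrow> \<bar>hat_op M T u \<psi> x\<bar> \<le> C'"
    let ?h = "\<lambda>x. hat_op M T u \<psi> x - \<psi> x"
    have h: "\<bar>?h x\<bar> \<le> C' + C" if "x \<in> space M" for x using C[of x] C'[OF that] by linarith
    have int\<psi>: "integrable M \<psi>" using C by (intro integrable_const_bound[where B = C]) auto
    have "?h \<in> K"
      unfolding K_def mem_Collect_eq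
    proof (intro conjI)
      show "integrable M (\<lambda>x. (?h x)\<^sup>2)" using h by (intro sq_bounded) auto
      show "(\<integral>x. ?h x \<partial>M) = 0" using int\<psi> by (simp add: integrable_hat_op_iff integral_hat_op)
      show "ratio_null b ?h" using mono nonneg lim C by (rule ratio_null_coboundary)
    qed simp
    then show "(\<integral>x. r x * ?h x \<partial>M) = 0"
      unfolding r_def using h by (intro orth AE_I2)
  qed
  then have "AE x in M. r (T u x) = r x" for u by (metis minus_minus)
  then have const: "AE x in M. r x = (\<integral>x. r x \<partial>M)"
    by (rule invariant_AE_const[OF erg r])
  have "(\<integral>x. l x \<partial>M) = 0"
  proof -
    have "\<bar>\<integral>x. l x \<partial>M\<bar> \<le> (\<integral>x. \<bar>k n x - l x\<bar> \<partial>M)" for n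
    proof -
      have "(\<integral>x. k n x \<partial>M) = 0" using k by (auto simp: K_def)
      then have "\<bar>\<integral>x. l x \<partial>M\<bar> = \<bar>\<integral>x. k n x - l x \<partial>M\<bar>" using intK[OF k] l(1) by simp
      also have "\<dots> \<le> (\<integral>x. \<bar>k n x - l x\<bar> \<partial>M)" by (rule integral_abs_bound)
      finally show ?thesis .
    qed
    then have "\<bar>\<integral>x. l x \<partial>M\<bar> \<le> 0" by (intro LIMSEQ_le_const[OF l(2)]) auto
    then show ?thesis by simp
  qed
  then have r_eq: "(\<integral>x. r x \<partial>M) = (\<integral>x. \<phi> x \<partial>M)" unfolding r_def using int l(1) by simp
  let ?f = "\<lambda>x. \<phi> x - (\<integral>y. \<phi> y \<partial>M)"
  have f_eq: "(\<integral>x. \<bar>?f x - k n x\<bar> \<partial>M) = (\<integral>x. \<bar>k n x - l x\<bar> \<partial>M)" for n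
  proof (rule integral_cong_AE)
    show "AE x in M. \<bar>?f x - k n x\<bar> = \<bar>k n x - l x\<bar>"
      using const by eventually_elim (simp add: r_eq, simp add: r_def)
  qed (use intK[OF k] l(1) in auto)
  show ?thesis
  proof (rule ratio_null_closed[OF mono nonneg])
    fix \<eta> :: real assume "0 < \<eta>"
    with l(2) have "eventually (\<lambda>n. (\<integral>x. \<bar>k n x - l x\<bar> \<partial>M) < \<eta>) sequentially" by (rule order_tendstoD)
    then obtain n where "(\<integral>x. \<bar>k n x - l x\<bar> \<partial>M) < \<eta>"
      using eventually_happens'[OF sequentially_bot] by blast
    then show "\<exists>k. integrable M k \<and> ratio_null b k \<and> (\<integral>x. \<bar>?f x - k x\<bar> \<partial>M) < \<eta>"
      using intK[OF k] k by (intro exI[of _ "k n"]) (auto simp: f_eq K_def)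
  qed (use int in simp)
qed

text \<open>The bounded case extends by truncation. Truncating also moves the subtracted mean, by at
  most the same L1 distance, so \<open>\<eta> / 2\<close> is spent twice.\<close>

lemma box_ratio_tendsto:
  fixes b :: "nat \<Rightarrow> 'd \<Rightarrow> int"
  assumes erg: "ergodic_action M T"
    and mono: "mono b" and nonneg: "\<And>n j. 0 \<le> b n j"
    and lim: "\<And>j. filterlim (\<lambda>n. b n j) at_top sequentially"
    and \<phi>: "integrable M \<phi>"
  shows "AE x in M. (\<lambda>n. box_sum (b n) \<phi> x / box_sum (b n) (\<lambda>_. 1) x) \<longlonglongrightarrow> (\<integral>y. \<phi> y \<partial>M)"
proof -
  let ?c = "\<integral>y. \<phi> y \<partial>M"
  have [measurable]: "\<phi> \<in> borel_measurable M" using \<phi> by simp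
  define tr where "tr N x = max (- real N) (min (real N) (\<phi> x))" for N x
  have [measurable]: "tr N \<in> borel_measurable M" for N unfolding tr_def[abs_def] by measurable
  have tr_le: "\<bar>tr N x\<bar> \<le> real N" for N x by (auto simp: tr_def)
  have tr_int: "integrable M (tr N)" for N
    using tr_le by (intro integrable_const_bound[where B = "real N"]) auto
  have "(\<lambda>N. \<integral>x. \<bar>\<phi> x - tr N x\<bar> \<partial>M) \<longlonglongrightarrow> (\<integral>x. 0 \<partial>M)"
  proof (rule integral_dominated_convergence[where w = "\<lambda>x. \<bar>\<phi> x\<bar>"])
    have "(\<lambda>N. \<bar>\<phi> x - tr N x\<bar>) \<longlonglongrightarrow> 0" for x
    proof (rule tendsto_eventually)
      obtain N where N: "\<bar>\<phi> x\<bar> \<le> real N" using real_arch_simple by blast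
      have "\<bar>\<phi> x - tr n x\<bar> = 0" if "n \<ge> N" for n
      proof -
        have "\<bar>\<phi> x\<bar> \<le> real n" using N that by linarith
        then show ?thesis by (auto simp: tr_def)
      qed
      then show "eventually (\<lambda>n. \<bar>\<phi> x - tr n x\<bar> = 0) sequentially"
        unfolding eventually_sequentially by blast
    qed
    then show "AE x in M. (\<lambda>N. \<bar>\<phi> x - tr N x\<bar>) \<longlonglongrightarrow> 0" by simp
    show "AE x in M. norm \<bar>\<phi> x - tr N x\<bar> \<le> \<bar>\<phi> x\<bar>" for N by (auto simp: tr_def)
  qed (use \<phi> in auto)
  then have tr_lim: "(\<lambda>N. \<integral>x. \<bar>\<phi> x - tr N x\<bar> \<partial>M) \<longlonglongrightarrow> 0" by simp
  have "ratio_null b (\<lambda>x. \<phi> x - ?c)"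
  proof (rule ratio_null_closed[OF mono nonneg])
    fix \<eta> :: real assume "0 < \<eta>"
    then have "eventually (\<lambda>N. (\<integral>x. \<bar>\<phi> x - tr N x\<bar> \<partial>M) < \<eta> / 2) sequentially"
      by (intro order_tendstoD(2)[OF tr_lim]) simp
    then obtain N where N: "(\<integral>x. \<bar>\<phi> x - tr N x\<bar> \<partial>M) < \<eta> / 2"
      using eventually_happens'[OF sequentially_bot] by blast
    let ?d = "\<integral>y. tr N y \<partial>M"
    have cd: "\<bar>?c - ?d\<bar> \<le> (\<integral>x. \<bar>\<phi> x - tr N x\<bar> \<partial>M)"
    proof -
      have "?c - ?d = (\<integral>x. \<phi> x - tr N x \<partial>M)" using \<phi> tr_int by simp
      then show ?thesis using integral_abs_bound[of M "\<lambda>x. \<phi> x - tr N x"] by simp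
    qed
    have "(\<integral>x. \<bar>(\<phi> x - ?c) - (tr N x - ?d)\<bar> \<partial>M) \<le> (\<integral>x. \<bar>\<phi> x - tr N x\<bar> + \<bar>?c - ?d\<bar> \<partial>M)"
      using \<phi> tr_int by (intro integral_mono) auto
    also have "\<dots> = (\<integral>x. \<bar>\<phi> x - tr N x\<bar> \<partial>M) + \<bar>?c - ?d\<bar>"
      using \<phi> tr_int by (simp add: prob_space)
    also have "\<dots> < \<eta>" using cd N by linarith
    finally show "\<exists>k. integrable M k \<and> ratio_null b k \<and> (\<integral>x. \<bar>(\<phi> x - ?c) - k x\<bar> \<partial>M) < \<eta>"
      using tr_int tr_le ratio_null_bounded[OF erg mono nonneg lim, of "tr N" "real N"]
      by (intro exI[of _ "\<lambda>x. tr N x - ?d"]) auto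
  qed (use \<phi> in simp)
  then show ?thesis
    unfolding ratio_null_def using AE_regular_point
  proof eventually_elim
    case (elim x)
    have "box_sum (b n) (\<lambda>x. \<phi> x - ?c) x / box_sum (b n) (\<lambda>_. 1) x =
        box_sum (b n) \<phi> x / box_sum (b n) (\<lambda>_. 1) x - ?c" for n
    proof -
      have "0 < box_sum (b n) (\<lambda>_. 1) x" using box_sum_1_ge_1[OF elim(2), of "b n"] nonneg by simp
      moreover have "box_sum (b n) (\<lambda>x. \<phi> x - ?c) x = box_sum (b n) \<phi> x - ?c * box_sum (b n) (\<lambda>_. 1) x"
        using box_sum_add[of "b n" \<phi> "\<lambda>_. - ?c * 1"] box_sum_cmult[of "b n" "- ?c" "\<lambda>_. 1"] by simp
      ultimately show ?thesis by (simp add: field_simps)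
    qed
    then show ?case using elim(1) by (simp add: LIM_zero_iff)
  qed
qed

end

section \<open>From the metric to nested boxes\<close>

theorem theorem1p3:
  fixes M :: "'x measure"
    and T :: "int ^ 'd \<Rightarrow> 'x \<Rightarrow> 'x"
    and \<rho> :: "int ^ 'd \<Rightarrow> int ^ 'd \<Rightarrow> real"
    and \<phi> :: "'x \<Rightarrow> real"
  assumes "standard_probability_space M"
    and "nonsingular_action M T"
    and "ergodic_action M T"
    and "rectangular_metric \<rho>"
    and "integrable M \<phi>"
  shows "AE x in M.
    (\<lambda>n. (\<Sum>u\<in>metric_box \<rho> n. hat_op M T u \<phi> x) /
         (\<Sum>u\<in>metric_box \<rho> n. hat_op M T u (\<lambda>_. 1) x))
      \<longlonglongrightarrow> (\<integral>y. \<phi> y \<partial>M)"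
proof -
  interpret prob_space M using assms(1) by (simp add: standard_probability_space_def)
  interpret nonsingular M T by unfold_locales (rule assms(2))
  obtain F :: "'d \<Rightarrow> real \<Rightarrow> real" where F: "\<And>i. rectangular_gauge (F i)"
    and \<rho>: "\<And>u v. \<rho> u v = (MAX i. F i \<bar>of_int (u $ i) - of_int (v $ i)\<bar>)"
    using assms(4) unfolding rectangular_metric_def by blast
  define f where "f i = the_inv_into {0..} (F i)" for i
  define b where "b n i = \<lfloor>f i (real n)\<rfloor>" for n :: nat and i
  have bij: "bij_betw (F i) {0..} {0..}" and smono: "strict_mono_on {0..} (F i)" for i
    using F[of i] by (simp_all add: rectangular_gauge_def)
  have Ff: "F i (f i t) = t" "0 \<le> f i t" if "0 \<le> t" for i t
    unfolding f_def using that f_the_inv_into_f_bij_betw[OF bij[of i], of t]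
      bij_betwE[OF bij_betw_the_inv_into[OF bij[of i]]] by auto
  \<comment> \<open>One half of the adjunction between \<open>F i\<close> and its inverse; it yields
    both the nesting of the boxes and the growth of their sides.\<close>
  have f_ge: "s \<le> f i t" if "0 \<le> s" "0 \<le> t" "F i s \<le> t" for i s t
    using strict_mono_on_less_eq[OF smono[of i], of s "f i t"] Ff[OF that(2)] that by auto
  have box: "metric_box \<rho> n = int_box (b n) 0" for n
    using metric_box_eq[of F, OF F \<rho>] by (auto simp: int_box_def b_def f_def)
  have "AE x in M. (\<lambda>n. box_sum (b n) \<phi> x / box_sum (b n) (\<lambda>_. 1) x) \<longlonglongrightarrow> (\<integral>y. \<phi> y \<partial>M)"
  proof (rule box_ratio_tendsto)
    show "mono b"
    proof (intro monoI le_funI)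
      fix n n' :: nat and i assume "n \<le> n'"
      then have "f i (real n) \<le> f i (real n')" 
        using f_ge[of "f i (real n)" "real n'" i] Ff[of "real n" i] by auto
      then show "b n i \<le> b n' i" by (simp add: b_def floor_mono)
    qed
    show "0 \<le> b n i" for n i using Ff(2)[of "real n" i] by (simp add: b_def)
    show "filterlim (\<lambda>n. b n i) at_top sequentially" for i
      unfolding filterlim_at_top
    proof
      fix Z :: int
      \<comment> \<open>\<open>F i\<close> is finite at \<open>Z\<close>, so a ball of radius
        \<open>N\<close> already reaches that coordinate; \<open>max 0\<close> keeps the argument in
        the domain of \<open>F i\<close>.\<close>
      obtain N :: nat where N: "F i (max 0 (of_int Z)) \<le> real N" using real_arch_simple by blast
      have "Z \<le> b n i" if "n \<ge> N" for n
      proof -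
        have "max 0 (of_int Z) \<le> f i (real n)" 
          using f_ge[of "max 0 (of_int Z)" "real n" i] N that by auto
        then show ?thesis by (simp add: b_def le_floor_iff)
      qed
      then show "eventually (\<lambda>n. Z \<le> b n i) sequentially" unfolding eventually_sequentially by blast
    qed
  qed (use assms in auto)
  then show ?thesis by (simp add: box box_sum_def)
qed

end
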